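(* Let $n\ge4$ and $d\ge2$, and let $s=s_{\min}(n,d)$ be the smallest integer satisfying $\binom{N_d-s+1}{2}\le N_{2d}-ns$. Then $N_{d-1}<s<N_d$. If the Iarrobino-Kanev conjecture (as stated in the context) is true for the given values of $(n,d,s)$, then $$p(n,2d)\;\ge\;N_d-s.$$ In fact, then, any generic sum of squares in $\Sigma_{n,2d}$ that vanishes in a generic set of $s$ real points of $\mathbb{P}^{n-1}(\mathbb{R})$ has sos length equal to $N_d-s$.
   Context: For $n\ge1$, $e\ge0$ let $\mathbb{R}[\mathtt{x}]_e$ denote the space of forms of degree $e$ in $\mathbb{R}[\mathtt{x}]=\mathbb{R}[x_1,\dots,x_n]$, and write $N_e=N_{n,e}=\dim\mathbb{R}[\mathtt{x}]_e=\binom{n+e-1}{n-1}$. In the inequality defining $s$, $\binom{a}{2}$ means $a(a-1)/2$. Let $\Sigma_{n,2d}\subseteq\mathbb{R}[\mathtt{x}]_{2d}$ be the set of forms of degree $2d$ that are finite sums of squares of forms in $\mathbb{R}[\mathtt{x}]_d$. For $f\in\Sigma_{n,2d}$ the sos length $\ell(f)$ is the smallest $r\ge0$ such that $f=p_1^2+\cdots+p_r^2$ for some $p_1,\dots,p_r\in\mathbb{R}[\mathtt{x}]_d$, and $p(n,2d)=\sup\{\ell(f)\colon f\in\Sigma_{n,2d}\}$. For a homogeneous ideal $I\subseteq\mathbb{R}[\mathtt{x}]$ write $h_j(I)=\dim\mathbb{R}[\mathtt{x}]_j/I_j$. For a set $Z\subseteq\mathbb{P}^{n-1}(\mathbb{R})$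 let $I(Z)$ be its full (saturated) homogeneous vanishing ideal. A statement holds for a "general" (or "generic") set of $s$ points if it holds for all $s$-tuples of points in a nonempty Zariski open subset of $(\mathbb{P}^{n-1})^s$. Given $Z$, a statement holds for a "generic" sum of squares vanishing on $Z$ if it holds for all $f$ in the convex cone $\{f\in\Sigma_{n,2d}\colon f|_Z=0\}$ outside a proper algebraic subset of the linear span of that cone. Iarrobino-Kanev conjecture for $(n,d,s)$, where $n\ge3$, $d\ge2$, $N_{d-1}\le s<N_d$: if $I=I(Z)$ is the vanishing ideal of a set $Z$ of $s$ general points in $\mathbb{P}^{n-1}$, then $$h_{2d}(I^2)=\max\Bigl\{ns,\;N_{2d}-\binom{N_d-s+1}{2}\Bigr\},$$ except for $(n,d,s)=(3,2,5)$, $(4,2,9)$ and $(5,2,14)$, where $\max$ has to be replaced by $\min$. *)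

theory Defs
  imports
    "HOL-Analysis.Analysis"
    "HOL-Analysis.Finite_Function_Topology"
    "HOL-Library.Poly_Mapping"
    "HOL-Library.Extended_Nat"
begin

text \<open>
  A monomial with variables indexed by \<open>'v\<close> is its finitely supported exponent vector, and
  a polynomial is a finitely supported family of coefficients.  The ring operations are those of
  \<open>Poly_Mapping\<close>; the real vector space structure is that of
  \<open>HOL-Analysis.Finite_Function_Topology\<close>.  The ring in $n$ variables is
  \<open>'n rpoly\<close> with \<open>CARD('n) = n\<close>.
\<close>

type_synonym 'v monomial = "'v \<Rightarrow>\<^sub>0 nat"

type_synonym 'v rpoly = "'v monomial \<Rightarrow>\<^sub>0 real"

definition mdegree :: "'v monomial \<Rightarrow> nat" where
  "mdegree m = (\<Sum>i\<in>Poly_Mapping.keys m. Poly_Mapping.lookup m i)"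

definition peval :: "'v rpoly \<Rightarrow> ('v \<Rightarrow> real) \<Rightarrow> real" where
  "peval p a = (\<Sum>m\<in>Poly_Mapping.keys p. Poly_Mapping.lookup p m *
     (\<Prod>i\<in>Poly_Mapping.keys m. a i ^ Poly_Mapping.lookup m i))"

definition forms :: "nat \<Rightarrow> 'v rpoly set" where
  "forms e = {p. \<forall>m\<in>Poly_Mapping.keys p. mdegree m = e}"

text \<open>The number of monomials of degree \<open>e\<close> in \<open>n\<close> variables, i.e. the dimension
  $N_{n,e}$ of the space of forms of degree \<open>e\<close>.\<close>

definition num_forms :: "nat \<Rightarrow> nat \<Rightarrow> nat" where
  "num_forms n e = (n + e - 1) choose (n - 1)"

subsection \<open>Sums of squares\<close>

definition sum_of_squares :: "nat \<Rightarrow> nat \<Rightarrow> 'v rpoly \<Rightarrow> bool" where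
  "sum_of_squares d r f \<longleftrightarrow>
     (\<exists>p :: nat \<Rightarrow> 'v rpoly. (\<forall>i<r. p i \<in> forms d) \<and> f = (\<Sum>i<r. (p i)\<^sup>2))"

text \<open>The parameter \<open>d\<close> is half the degree: these are the cone $\Sigma_{n,2d}$, the length
  $\ell(f)$ of $f\in\Sigma_{n,2d}$, and $p(n,2d)$.\<close>

definition sos_cone :: "nat \<Rightarrow> 'v rpoly set" where
  "sos_cone d = {f \<in> forms (2 * d). \<exists>r. sum_of_squares d r f}"

definition sos_length :: "nat \<Rightarrow> 'v rpoly \<Rightarrow> nat" where
  "sos_length d f = (LEAST r. sum_of_squares d r f)"

definition max_sos_length :: "'v itself \<Rightarrow> nat \<Rightarrow> enat" where
  "max_sos_length _ d = (SUP f\<in>(sos_cone d :: 'v rpoly set). enat (sos_length d f))"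

subsection \<open>Points of real projective space\<close>

text \<open>A point of $\mathbb{P}^{n-1}(\mathbb{R})$ is a line through the origin of $\mathbb{R}^n$.\<close>

definition proj_space :: "(real ^ 'n) set set" where
  "proj_space = {L. subspace L \<and> dim L = 1}"

text \<open>For a form it makes no difference that the zero vector belongs to every line.\<close>

definition vanishes_on :: "'n::finite rpoly \<Rightarrow> (real ^ 'n) set set \<Rightarrow> bool" where
  "vanishes_on f Z \<longleftrightarrow> (\<forall>L\<in>Z. \<forall>v\<in>L. peval f (($) v) = 0)"

definition proj_tuples :: "nat \<Rightarrow> (nat \<Rightarrow> (real ^ 'n) set) set" where
  "proj_tuples s = {..<s} \<rightarrow>\<^sub>E proj_space"

text \<open>Forms on $(\mathbb{P}^{n-1})^s$: polynomials in variables $x_{i,j}$ with $i<s$, homogeneous of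
  some degree \<open>a i\<close> in each block $(x_{i,j})_j$.\<close>

definition multiforms :: "nat \<Rightarrow> (nat \<times> 'n::finite) rpoly set" where
  "multiforms s = {F. \<exists>a :: nat \<Rightarrow> nat. \<forall>m\<in>Poly_Mapping.keys F. \<forall>i.
     (\<Sum>j\<in>UNIV. Poly_Mapping.lookup m (i, j)) = (if i < s then a i else 0)}"

definition zariski_closed :: "nat \<Rightarrow> (nat \<Rightarrow> (real ^ 'n::finite) set) set \<Rightarrow> bool" where
  "zariski_closed s A \<longleftrightarrow> (\<exists>\<F> \<subseteq> multiforms s.
     A = {z \<in> proj_tuples s. \<forall>F\<in>\<F>. \<forall>v :: nat \<Rightarrow> real ^ 'n.
            (\<forall>i<s. v i \<in> z i) \<longrightarrow> peval F (\<lambda>(i, j). v i $ j) = 0})"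

definition zariski_open :: "nat \<Rightarrow> (nat \<Rightarrow> (real ^ 'n::finite) set) set \<Rightarrow> bool" where
  "zariski_open s U \<longleftrightarrow> U \<subseteq> proj_tuples s \<and> zariski_closed s (proj_tuples s - U)"

definition for_general_points :: "nat \<Rightarrow> ((real ^ 'n::finite) set set \<Rightarrow> bool) \<Rightarrow> bool" where
  "for_general_points s P \<longleftrightarrow>
     (\<exists>U. zariski_open s U \<and> U \<noteq> {} \<and> (\<forall>z\<in>U. P (z ` {..<s})))"

subsection \<open>Ideals and Hilbert functions\<close>

definition is_ideal :: "'a::comm_ring_1 set \<Rightarrow> bool" where
  "is_ideal I \<longleftrightarrow> 0 \<in> I \<and> (\<forall>f\<in>I. \<forall>g\<in>I. f + g \<in> I) \<and> (\<forall>a. \<forall>f\<in>I. a * f \<in> I)"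

definition ideal_mult :: "'a::comm_ring_1 set \<Rightarrow> 'a set \<Rightarrow> 'a set" where
  "ideal_mult I J = is_ideal hull {f * g | f g. f \<in> I \<and> g \<in> J}"

definition vanishing_ideal :: "(real ^ 'n::finite) set set \<Rightarrow> 'n rpoly set" where
  "vanishing_ideal Z = is_ideal hull {f. (\<exists>e. f \<in> forms e) \<and> vanishes_on f Z}"

text \<open>Dimension of $V/W$: the least number of elements of $V$ whose classes span $V/W$.\<close>

definition quotient_dim :: "'a::real_vector set \<Rightarrow> 'a set \<Rightarrow> nat" where
  "quotient_dim V W = (LEAST k. \<exists>B\<subseteq>V. finite B \<and> card B = k \<and> V \<subseteq> span (B \<union> W))"

definition hilbert_fun :: "nat \<Rightarrow> 'v rpoly set \<Rightarrow> nat" where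
  "hilbert_fun j I = quotient_dim (forms j) (I \<inter> forms j)"

subsection \<open>The conjecture and the critical number of points\<close>

definition binom2 :: "int \<Rightarrow> int" where
  "binom2 a = a * (a - 1) div 2"

text \<open>Meant for $n\ge3$, $d\ge2$ and $N_{d-1}\le s<N_d$.\<close>

definition iarrobino_kanev :: "'n::finite itself \<Rightarrow> nat \<Rightarrow> nat \<Rightarrow> bool" where
  "iarrobino_kanev _ d s \<longleftrightarrow>
     for_general_points s (\<lambda>Z :: (real ^ 'n) set set.
       let n = CARD('n); I = vanishing_ideal Z;
           a = int (n * s);
           b = int (num_forms n (2 * d)) - binom2 (int (num_forms n d) - int s + 1)
       in int (hilbert_fun (2 * d) (ideal_mult I I)) =
            (if (n, d, s) \<in> {(3, 2, 5), (4, 2, 9), (5, 2, 14)} then min a b else max a b))"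

definition s_min :: "nat \<Rightarrow> nat \<Rightarrow> int" where
  "s_min n d = (LEAST s :: int.
     binom2 (int (num_forms n d) - s + 1) \<le> int (num_forms n (2 * d)) - int n * s)"

subsection \<open>Generic sums of squares vanishing on a set of points\<close>

text \<open>The coordinates of a polynomial \<open>f\<close> are its coefficients, so a polynomial function on
  a space of polynomials is given by a polynomial in variables indexed by monomials.\<close>

definition algebraic_subset :: "'v rpoly set \<Rightarrow> 'v rpoly set \<Rightarrow> bool" where
  "algebraic_subset V W \<longleftrightarrow>
     (\<exists>\<P> :: 'v monomial rpoly set. W = {f \<in> V. \<forall>P\<in>\<P>. peval P (Poly_Mapping.lookup f) = 0})"

definition vanishing_sos :: "nat \<Rightarrow> (real ^ 'n::finite) set set \<Rightarrow> 'n rpoly set" where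
  "vanishing_sos d Z = {f \<in> sos_cone d. vanishes_on f Z}"

definition for_generic_vanishing_sos ::
    "nat \<Rightarrow> (real ^ 'n::finite) set set \<Rightarrow> ('n rpoly \<Rightarrow> bool) \<Rightarrow> bool" where
  "for_generic_vanishing_sos d Z P \<longleftrightarrow>
     (\<exists>W. algebraic_subset (span (vanishing_sos d Z)) W \<and> W \<noteq> span (vanishing_sos d Z) \<and>
          (\<forall>f \<in> vanishing_sos d Z - W. P f))"

end

theory Submission
  imports Defs "Jordan_Normal_Form.Determinant"
begin

text \<open>
  Let \<open>t = N\<^sub>d - s\<close>.  General points impose independent conditions on forms, so
  $I_{d-1}=0$ and $\dim I_d=t$; hence $(I^2)_{2d}$ is spanned by the products of two elements of
  $I_d$.  The conjectured value of $h_{2d}(I^2)$ says that it has dimension $\binom{t+1}{2}$, i.e.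
  that the products $b_jb_i$ ($i\le j$) of basis elements of $I_d$ are linearly independent.  At real
  points the squares of a sum of squares vanish separately, so a sum of squares vanishing on \<open>Z\<close> is a
  sum of squares of elements of $I_d$, and has a unique Gram matrix with respect to the $b_i$, of
  size \<open>t\<close>.  Its length is at most \<open>t\<close>, and it is exactly \<open>t\<close> where the determinant of the Gram
  matrix, a polynomial in the coefficients, does not vanish.
\<close>

subsection \<open>Polynomials, monomials and forms\<close>

text \<open>Three numerical facts about \<open>s_min\<close> enter. Its defining inequality selects
  the second entry of the maximum; s + n \<le> N_d keeps the triple away from the exceptional cases,
  all of which have s = N_d - 1; and N_{d-1} < s makes I_{d-1} vanish, without which products of
  elements of degrees e and 2d - e with e < d could also contribute to degree 2d. The evaluation
  conditions yield the bound dim I_d \<le> t; equality is recovered from the Hilbert function, since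
  fewer than t forms have too few products. Several generic properties must hold at the same points.
  Each is witnessed by one multihomogeneous polynomial that is not identically zero, and a product
  of witnesses stands for an intersection of open sets. The upper bound for the length does not
  diagonalise the Gram matrix: a linear relation between the summands lets one square be absorbed by
  the others. The vanishing ideal and its square are hulls in an ungraded sense, so their parts in
  degree d and 2d are reached as lowest components.\<close>

lemma poly_mapping_sum_single:
  "p = (\<Sum>m\<in>Poly_Mapping.keys p. Poly_Mapping.single m (Poly_Mapping.lookup p m))"
  by (intro poly_mapping_eqI)
    (auto simp: lookup_sum lookup_single when_def in_keys_iff if_distrib sum.delta)

lemma lookup_scaleR [simp]:
  "Poly_Mapping.lookup (c *\<^sub>R p) m = c *\<^sub>R Poly_Mapping.lookup p m"
proof -
  have "finite {x. c *\<^sub>R Poly_Mapping.lookup p x \<noteq> 0}"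
    by (rule finite_subset[OF _ finite_keys[of p]]) (auto simp: in_keys_iff)
  then show ?thesis
    by (simp add: scaleR_poly_mapping_def)
qed

text \<open>Links the vector space structure to the ring structure, so that scalar laws become ring
  laws.\<close>

lemma scaleR_rpoly: "c *\<^sub>R p = Poly_Mapping.single 0 c * (p :: 'v rpoly)"
proof -
  have "Poly_Mapping.single 0 c * p = Poly_Mapping.map ((*) c) p"
    by (simp add: mult_map_scale_conv_mult)
  also have "\<dots> = c *\<^sub>R p"
    by (rule poly_mapping_eqI) (simp add: Poly_Mapping.map.rep_eq when_def)
  finally show ?thesis by simp
qed

lemma scaleR_mult_rpoly:
  "(c *\<^sub>R p) * q = c *\<^sub>R (p * (q :: 'v rpoly))" "p * (c *\<^sub>R q) = c *\<^sub>R (p * q)"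
  by (simp_all add: scaleR_rpoly ac_simps)

lemma keys_scaleR: "Poly_Mapping.keys (c *\<^sub>R p) \<subseteq> Poly_Mapping.keys p"
  by (auto simp: in_keys_iff)

definition mono_eval :: "'v monomial \<Rightarrow> ('v \<Rightarrow> real) \<Rightarrow> real" where
  "mono_eval m a = (\<Prod>i\<in>Poly_Mapping.keys m. a i ^ Poly_Mapping.lookup m i)"

lemma mono_eval_superset:
  assumes "finite V" "Poly_Mapping.keys m \<subseteq> V"
  shows "mono_eval m a = (\<Prod>i\<in>V. a i ^ Poly_Mapping.lookup m i)"
  unfolding mono_eval_def
  by (rule prod.mono_neutral_left) (use assms in \<open>auto simp: in_keys_iff\<close>)

lemma mono_eval_0 [simp]: "mono_eval 0 a = 1"
  by (simp add: mono_eval_def)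

lemma mono_eval_add: "mono_eval (m + m') a = mono_eval m a * mono_eval m' a"
proof -
  let ?V = "Poly_Mapping.keys m \<union> Poly_Mapping.keys m'"
  have "mono_eval (m + m') a = (\<Prod>i\<in>?V. a i ^ Poly_Mapping.lookup (m + m') i)"
    by (rule mono_eval_superset[OF _ keys_add]) simp
  also have "\<dots> = (\<Prod>i\<in>?V. a i ^ Poly_Mapping.lookup m i) * (\<Prod>i\<in>?V. a i ^ Poly_Mapping.lookup m' i)"
    by (simp add: lookup_add power_add prod.distrib)
  also have "\<dots> = mono_eval m a * mono_eval m' a"
    by (simp add: mono_eval_superset[of ?V])
  finally show ?thesis .
qed

lemma peval_superset:
  assumes "finite M" "Poly_Mapping.keys p \<subseteq> M"
  shows "peval p a = (\<Sum>m\<in>M. Poly_Mapping.lookup p m * mono_eval m a)"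
  unfolding peval_def mono_eval_def[symmetric]
  by (rule sum.mono_neutral_left) (use assms in \<open>auto simp: in_keys_iff\<close>)

lemma peval_0 [simp]: "peval 0 a = 0"
  by (simp add: peval_def)

lemma peval_single [simp]: "peval (Poly_Mapping.single m c) a = c * mono_eval m a"
  by (subst peval_superset[of "{m}"]) auto

lemma peval_1 [simp]: "peval 1 a = 1"
  using peval_single[of 0 1 a] by simp

lemma peval_add: "peval (p + q) a = peval p a + peval q a"
proof -
  let ?M = "Poly_Mapping.keys p \<union> Poly_Mapping.keys q"
  have "peval (p + q) a = (\<Sum>m\<in>?M. Poly_Mapping.lookup (p + q) m * mono_eval m a)"
    by (rule peval_superset[OF _ keys_add]) simp
  also have "\<dots> = peval p a + peval q a"
    by (simp add: lookup_add distrib_right sum.distrib peval_superset[of ?M])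
  finally show ?thesis .
qed

lemma peval_sum: "peval (sum f A) a = (\<Sum>x\<in>A. peval (f x) a)"
  by (induction A rule: infinite_finite_induct) (simp_all add: peval_add)

lemma peval_mult: "peval (p * q) a = peval p a * peval q a"
proof -
  have "p * q = (\<Sum>m\<in>Poly_Mapping.keys p. \<Sum>m'\<in>Poly_Mapping.keys q.
      Poly_Mapping.single (m + m') (Poly_Mapping.lookup p m * Poly_Mapping.lookup q m'))"
    using arg_cong2[of _ _ _ _ "(*)", OF poly_mapping_sum_single[of p] poly_mapping_sum_single[of q]]
    by (simp add: sum_product mult_single)
  then have "peval (p * q) a = (\<Sum>m\<in>Poly_Mapping.keys p. \<Sum>m'\<in>Poly_Mapping.keys q.
      (Poly_Mapping.lookup p m * mono_eval m a) * (Poly_Mapping.lookup q m' * mono_eval m' a))"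
    by (simp add: peval_sum mono_eval_add mult_ac)
  also have "\<dots> = peval p a * peval q a"
    by (simp add: sum_product peval_superset[of "Poly_Mapping.keys p" p]
        peval_superset[of "Poly_Mapping.keys q" q])
  finally show ?thesis .
qed

lemma peval_scaleR [simp]: "peval (c *\<^sub>R p) a = c * peval p a"
  by (simp add: scaleR_rpoly peval_mult)

lemma peval_uminus [simp]: "peval (- p) a = - peval p a"
  using peval_scaleR[of "-1" p a] by simp

lemma peval_diff: "peval (p - q) a = peval p a - peval q a"
  using peval_add[of p "- q" a] by simp

lemma peval_power: "peval (p ^ k) a = peval p a ^ k"
  by (induction k) (simp_all add: peval_mult)

lemma comm_ring_hom_peval: "comm_ring_hom (\<lambda>p. peval p a)"
  by unfold_locales (simp_all add: peval_add peval_mult)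

text \<open>Two determinants of polynomials are formed later, one in the coordinates of the points
  and one in the coefficients of a form; evaluation turns both into determinants of real
  matrices.\<close>

lemma peval_det: "peval (det M) a = det (map_mat (\<lambda>p. peval p a) M)"
  by (rule comm_ring_hom.hom_det[OF comm_ring_hom_peval, symmetric])

section \<open>Degrees and the spaces of forms\<close>

lemma mdegree_superset:
  assumes "finite V" "Poly_Mapping.keys m \<subseteq> V"
  shows "mdegree m = (\<Sum>i\<in>V. Poly_Mapping.lookup m i)"
  unfolding mdegree_def
  by (rule sum.mono_neutral_left) (use assms in \<open>auto simp: in_keys_iff\<close>)

lemma mdegree_0 [simp]: "mdegree 0 = 0"
  by (simp add: mdegree_def)

lemma mdegree_eq_0_iff: "mdegree m = 0 \<longleftrightarrow> m = 0"
proof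
  assume "mdegree m = 0"
  then have *: "\<forall>i\<in>Poly_Mapping.keys m. Poly_Mapping.lookup m i = 0"
    by (simp add: mdegree_def)
  show "m = 0"
  proof (rule poly_mapping_eqI)
    show "Poly_Mapping.lookup m i = Poly_Mapping.lookup 0 i" for i
      using * by (cases "i \<in> Poly_Mapping.keys m") (auto simp: in_keys_iff)
  qed
qed simp

lemma mdegree_single [simp]: "mdegree (Poly_Mapping.single i k) = k"
  by (subst mdegree_superset[of "{i}"]) auto

lemma mdegree_add: "mdegree (m + m') = mdegree m + mdegree m'"
proof -
  let ?V = "Poly_Mapping.keys m \<union> Poly_Mapping.keys m'"
  have "mdegree (m + m') = (\<Sum>i\<in>?V. Poly_Mapping.lookup (m + m') i)"
    by (rule mdegree_superset[OF _ keys_add]) simp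
  also have "\<dots> = mdegree m + mdegree m'"
    by (simp add: lookup_add sum.distrib mdegree_superset[of ?V])
  finally show ?thesis .
qed

lemma subspace_forms: "subspace (forms e)"
  unfolding subspace_def forms_def
  using keys_add keys_scaleR by (fastforce simp: subset_iff)

lemma forms_mult:
  assumes "p \<in> forms e" "q \<in> forms e'"
  shows "p * q \<in> forms (e + e')"
proof -
  have "mdegree m = e + e'" if "m \<in> Poly_Mapping.keys (p * q)" for m
    using keys_mult[of p q] that assms by (fastforce simp: forms_def mdegree_add)
  then show ?thesis by (simp add: forms_def)
qed

text \<open>Along an enumeration \<open>f\<close> of the variables a monomial becomes the list of
  its exponents, and lists of given length and sum are counted by stars and bars.\<close>

lemma card_monomials:
  "finite {m :: 'n::finite monomial. mdegree m = e}"
  "card {m :: 'n monomial. mdegree m = e} = num_forms CARD('n) e"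
proof -
  let ?n = "CARD('n)"
  let ?L = "{l :: nat list. length l = ?n \<and> sum_list l = e}"
  obtain f :: "nat \<Rightarrow> 'n" where f: "bij_betw f {..<?n} UNIV"
    using ex_bij_betw_nat_finite[of "UNIV :: 'n set"] by (auto simp: atLeast0LessThan)
  define \<Phi> where "\<Phi> m = map (\<lambda>i. Poly_Mapping.lookup m (f i)) [0..<?n]" for m :: "'n monomial"
  have deg: "sum_list (\<Phi> m) = mdegree m" for m :: "'n monomial"
  proof -
    have "sum_list (\<Phi> m) = (\<Sum>i<?n. Poly_Mapping.lookup m (f i))"
      unfolding \<Phi>_def by (simp only: interv_sum_list_conv_sum_set_nat set_upt atLeast0LessThan)
    also have "\<dots> = (\<Sum>i\<in>UNIV. Poly_Mapping.lookup m i)"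
      by (rule sum.reindex_bij_betw[OF f])
    finally show ?thesis by (simp add: mdegree_superset[of UNIV])
  qed
  have inj: "inj \<Phi>"
  proof (rule injI)
    fix m m' assume *: "\<Phi> m = \<Phi> m'"
    show "m = m'"
    proof (rule poly_mapping_eqI)
      fix j obtain i where "i < ?n" "j = f i"
        using f by (auto simp: bij_betw_def)
      moreover have "\<Phi> m ! i = \<Phi> m' ! i" using * by simp
      ultimately show "Poly_Mapping.lookup m j = Poly_Mapping.lookup m' j"
        by (simp add: \<Phi>_def)
    qed
  qed
  have surj: "\<exists>m. \<Phi> m = l" if "length l = ?n" for l
  proof
    let ?m = "Abs_poly_mapping (\<lambda>j. l ! inv_into {..<?n} f j)"
    show "\<Phi> ?m = l"
      using that f by (intro nth_equalityI) (auto simp: \<Phi>_def bij_betw_def)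
  qed
  have "\<Phi> ` {m. mdegree m = e} = ?L"
  proof safe
    fix m :: "'n monomial" assume "e = mdegree m"
    show "length (\<Phi> m) = ?n" by (simp add: \<Phi>_def)
  next
    fix l assume l: "length l = ?n" "e = sum_list l"
    then obtain m where "\<Phi> m = l" using surj by blast
    then show "l \<in> \<Phi> ` {m. mdegree m = sum_list l}" using deg[of m] l by auto
  qed (simp add: deg)
  then have bij: "bij_betw \<Phi> {m. mdegree m = e} ?L"
    using inj by (auto simp: bij_betw_def intro: inj_on_subset)
  have "?L \<subseteq> {l. set l \<subseteq> {..e} \<and> length l = ?n}"
    using member_le_sum_list by auto
  moreover have "finite {l. set l \<subseteq> {..e} \<and> length l = ?n}"
    by (rule finite_lists_length_eq) simp
  ultimately have "finite ?L" by (rule finite_subset)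
  then show "finite {m :: 'n monomial. mdegree m = e}"
    using bij bij_betw_finite by blast
  have "card {m :: 'n monomial. mdegree m = e} = (e + ?n - 1) choose e"
    using bij_betw_same_card[OF bij] card_length_sum_list[of ?n e] by simp
  also have "\<dots> = (?n + e - 1) choose (?n - 1)"
    using binomial_symmetric[of e "e + ?n - 1"] zero_less_card_finite[where 'a = 'n]
    by (simp add: add.commute del: zero_less_card_finite)
  finally show "card {m :: 'n monomial. mdegree m = e} = num_forms ?n e"
    by (simp add: num_forms_def)
qed

section \<open>Linear independence of indexed families\<close>

lemma inj_single_1: "inj (\<lambda>m. Poly_Mapping.single m (1 :: real))"
proof (rule injI)
  fix m m' :: 'a assume "Poly_Mapping.single m (1 :: real) = Poly_Mapping.single m' 1"
  then have "Poly_Mapping.lookup (Poly_Mapping.single m (1 :: real)) m =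
      Poly_Mapping.lookup (Poly_Mapping.single m' 1) m" by simp
  then show "m = m'" by (simp add: lookup_single when_def split: if_splits)
qed

text \<open>Independence of a set forgets repetitions, so injectivity is a separate conclusion:
  equal members would satisfy a relation with coefficients 1 and -1.\<close>

lemma independent_imageI:
  assumes "finite I" and "\<And>u i. (\<Sum>i\<in>I. u i *\<^sub>R b i) = 0 \<Longrightarrow> i \<in> I \<Longrightarrow> u i = 0"
  shows "independent (b ` I)" and "inj_on b I"
proof -
  show inj: "inj_on b I"
  proof (rule inj_onI, rule ccontr)
    fix i j assume ij: "i \<in> I" "j \<in> I" "b i = b j" "i \<noteq> j"
    let ?u = "\<lambda>k. if k = i then 1 else if k = j then - 1 else (0 :: real)"
    have "(\<Sum>k\<in>I. ?u k *\<^sub>R b k) = (\<Sum>k\<in>{i, j}. ?u k *\<^sub>R b k)"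
      by (rule sum.mono_neutral_right) (use assms(1) ij in auto)
    also have "\<dots> = 0" using ij by simp
    finally show False using assms(2)[of ?u i] ij by simp
  qed
  show "independent (b ` I)"
  proof (rule independent_if_scalars_zero)
    fix u x assume "(\<Sum>x\<in>b ` I. u x *\<^sub>R x) = 0" and x: "x \<in> b ` I"
    then have "(\<Sum>i\<in>I. u (b i) *\<^sub>R b i) = 0"
      by (simp add: sum.reindex[OF inj])
    then show "u x = 0" using assms(2)[of "\<lambda>i. u (b i)"] x by auto
  qed (use assms(1) in simp)
qed

text \<open>A nontrivial relation expresses one member through the others, which pushes the
  dimension of the span below \<open>card I\<close>.\<close>

lemma family_scalars_zero:
  assumes I: "finite I" "card I \<le> dim (b ` I)"
    and u: "(\<Sum>i\<in>I. u i *\<^sub>R b i) = 0" "i \<in> I"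
  shows "u i = 0"
proof (rule ccontr)
  assume "u i \<noteq> 0"
  let ?S = "span (b ` (I - {i}))"
  have "u i *\<^sub>R b i = - (\<Sum>j\<in>I - {i}. u j *\<^sub>R b j)"
    using u I by (simp add: sum.remove eq_neg_iff_add_eq_0)
  also have "\<dots> \<in> ?S" by (intro span_neg span_sum span_scale span_base) auto
  finally have "inverse (u i) *\<^sub>R u i *\<^sub>R b i \<in> ?S" by (rule span_scale)
  then have "b i \<in> ?S" using \<open>u i \<noteq> 0\<close> by simp
  then have "b ` I \<subseteq> ?S" by (auto intro: span_base)
  then have "dim (b ` I) \<le> card (b ` (I - {i}))" using I by (intro dim_le_card) auto
  also have "\<dots> \<le> card (I - {i})" using I by (intro card_image_le) auto
  also have "\<dots> < card I" using I u by (intro psubset_card_mono) auto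
  finally show False using I by simp
qed

lemma independent_singles:
  assumes "finite M"
  shows "independent ((\<lambda>m. Poly_Mapping.single m (1 :: real)) ` M)"
proof (rule independent_imageI[OF assms])
  let ?s = "\<lambda>m. Poly_Mapping.single m (1 :: real)"
  fix u m assume u: "(\<Sum>m\<in>M. u m *\<^sub>R ?s m) = 0" and m: "m \<in> M"
  have "0 = Poly_Mapping.lookup (\<Sum>m\<in>M. u m *\<^sub>R ?s m) m" using u by simp
  also have "\<dots> = (\<Sum>m'\<in>M. if m' = m then u m' else 0)"
    unfolding lookup_sum by (rule sum.cong) (auto simp: lookup_single when_def)
  also have "\<dots> = u m" using assms m by simp
  finally show "u m = 0" by simp
qed

lemma forms_eq_span:
  "forms e = span ((\<lambda>m. Poly_Mapping.single m (1 :: real)) ` {m :: 'n::finite monomial. mdegree m = e})"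
proof
  show "forms e \<subseteq> span ((\<lambda>m. Poly_Mapping.single m (1 :: real)) ` {m :: 'n monomial. mdegree m = e})"
  proof
    fix p :: "'n rpoly" assume p: "p \<in> forms e"
    have eq: "Poly_Mapping.single m c = c *\<^sub>R Poly_Mapping.single m (1 :: real)"
      for m :: "'n monomial" and c
      by (simp add: scaleR_rpoly mult_single)
    show "p \<in> span ((\<lambda>m. Poly_Mapping.single m (1 :: real)) ` {m :: 'n monomial. mdegree m = e})"
      by (subst poly_mapping_sum_single[of p], subst eq, intro span_sum span_scale span_base)
        (use p in \<open>auto simp: forms_def\<close>)
  qed
qed (rule span_minimal, auto simp: subspace_forms, auto simp: forms_def)

lemma dim_forms: "dim (forms e :: 'n::finite rpoly set) = num_forms CARD('n) e"
proof -
  let ?B = "(\<lambda>m. Poly_Mapping.single m (1 :: real)) ` {m :: 'n monomial. mdegree m = e}"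
  have "dim (forms e :: 'n rpoly set) = card ?B"
    unfolding forms_eq_span dim_span
    by (rule dim_eq_card_independent, rule independent_singles, rule card_monomials)
  also have "\<dots> = num_forms CARD('n) e"
    by (simp add: card_image inj_on_subset[OF inj_single_1] card_monomials)
  finally show ?thesis .
qed

subsection \<open>Polynomial functions\<close>

lemma monomial_functions_independent:
  fixes c :: "'b \<Rightarrow> real" and e :: "'b \<Rightarrow> 'v \<Rightarrow> nat"
  assumes "finite V" "finite M"
    and "\<And>m m'. m \<in> M \<Longrightarrow> m' \<in> M \<Longrightarrow> (\<And>i. i \<in> V \<Longrightarrow> e m i = e m' i) \<Longrightarrow> m = m'"
    and "\<And>a. (\<Sum>m\<in>M. c m * (\<Prod>i\<in>V. a i ^ e m i)) = 0"
    and "m \<in> M"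
  shows "c m = 0"
  using assms
proof (induction V arbitrary: M m rule: finite_induct)
  case empty
  then have "M = {m}" by auto
  then show ?case using empty.prems(3) by simp
next
  case (insert x V)
  let ?k = "e m x"
  let ?M = "{m' \<in> M. e m' x = ?k}"
  show ?case
  proof (rule insert.IH)
    show "finite ?M" using insert.prems(1) by simp
    show "m \<in> ?M" using insert.prems(4) by simp
    show "m1 = m2" if "m1 \<in> ?M" "m2 \<in> ?M" "\<And>i. i \<in> V \<Longrightarrow> e m1 i = e m2 i" for m1 m2
      by (rule insert.prems(2)) (use that in auto)
    show "(\<Sum>m\<in>?M. c m * (\<Prod>i\<in>V. a i ^ e m i)) = 0" for a
    proof -
      let ?c = "\<lambda>m. c m * (\<Prod>i\<in>V. a i ^ e m i)"
      define P where "P = (\<Sum>m\<in>M. monom (?c m) (e m x))"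
      have "poly P t = 0" for t
      proof -
        have "(\<Prod>i\<in>V. (a(x := t)) i ^ e m i) = (\<Prod>i\<in>V. a i ^ e m i)" for m
          by (rule prod.cong) (use insert.hyps in auto)
        then have "poly P t = (\<Sum>m\<in>M. c m * (\<Prod>i\<in>insert x V. (a(x := t)) i ^ e m i))"
          using insert.hyps by (simp add: P_def poly_sum poly_monom mult_ac)
        also have "\<dots> = 0" by (rule insert.prems(3))
        finally show ?thesis .
      qed
      then have "P = 0" using poly_all_0_iff_0 by blast
      then have "0 = coeff P ?k" by simp
      also have "\<dots> = (\<Sum>m\<in>M. if e m x = ?k then ?c m else 0)"
        by (simp add: P_def coeff_sum)
      also have "\<dots> = (\<Sum>m\<in>?M. ?c m)"
        by (rule sum.inter_filter[symmetric]) (rule insert.prems(1))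
      finally show ?thesis by simp
    qed
  qed
qed

lemma peval_nonzero:
  fixes p :: "'n::finite rpoly"
  assumes "p \<noteq> 0"
  obtains a where "peval p a \<noteq> 0"
proof (rule ccontr)
  assume "\<not> thesis"
  then have *: "peval p a = 0" for a using that by blast
  have "p = 0"
  proof (rule poly_mapping_eqI)
    fix m
    have "Poly_Mapping.lookup p m = 0" if "m \<in> Poly_Mapping.keys p"
    proof (rule monomial_functions_independent[where V = UNIV and e = Poly_Mapping.lookup])
      show "m1 = m2" if "\<And>i. i \<in> UNIV \<Longrightarrow> Poly_Mapping.lookup m1 i = Poly_Mapping.lookup m2 i"
        for m1 m2 :: "'n monomial"
        using that by (intro poly_mapping_eqI) auto
      show "(\<Sum>m\<in>Poly_Mapping.keys p. Poly_Mapping.lookup p m *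
          (\<Prod>i\<in>UNIV. a i ^ Poly_Mapping.lookup m i)) = 0" for a
        using *[of a] by (simp add: peval_superset[of "Poly_Mapping.keys p"] mono_eval_superset[of UNIV])
    qed (use that in auto)
    then show "Poly_Mapping.lookup p m = Poly_Mapping.lookup 0 m"
      by (cases "m \<in> Poly_Mapping.keys p") (auto simp: in_keys_iff)
  qed
  with assms show False by simp
qed

lemma peval_line:
  "\<exists>P :: real poly. \<forall>t. poly P t = peval F (\<lambda>i. v i + t * (w i - v i))"
proof
  let ?P = "\<Sum>m\<in>Poly_Mapping.keys F. [:Poly_Mapping.lookup F m:] *
    (\<Prod>i\<in>Poly_Mapping.keys m. [:v i, w i - v i:] ^ Poly_Mapping.lookup m i)"
  show "\<forall>t. poly ?P t = peval F (\<lambda>i. v i + t * (w i - v i))"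
    by (simp add: poly_sum poly_prod poly_power peval_def)
qed

text \<open>Irreducibility of affine space: on the line through the two given points both functions are
  nonzero polynomials in one variable.\<close>

lemma common_nonvanishing:
  assumes "peval F v \<noteq> 0" "peval G w \<noteq> 0"
  obtains u where "peval F u \<noteq> 0" "peval G u \<noteq> 0"
proof -
  obtain P where P: "\<And>t. poly P t = peval F (\<lambda>i. v i + t * (w i - v i))"
    using peval_line by metis
  obtain Q where Q: "\<And>t. poly Q t = peval G (\<lambda>i. v i + t * (w i - v i))"
    using peval_line by metis
  have "poly P 0 \<noteq> 0" "poly Q 1 \<noteq> 0" using assms by (simp_all add: P Q)
  then have "P * Q \<noteq> 0" by auto
  then obtain t where "poly (P * Q) t \<noteq> 0" using poly_all_0_iff_0 by blast
  then show ?thesis using that P Q by (metis mult_eq_0_iff poly_mult)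
qed

subsection \<open>Multihomogeneous polynomials\<close>

text \<open>Keeps the vector of block degrees explicit, to be tracked through products and
  determinants; \<open>multiforms\<close> merely asserts that such a vector exists.\<close>

definition mhom :: "(nat \<Rightarrow> nat) \<Rightarrow> (nat \<times> 'n::finite) rpoly \<Rightarrow> bool" where
  "mhom a F \<longleftrightarrow> (\<forall>m\<in>Poly_Mapping.keys F. \<forall>i. (\<Sum>j\<in>UNIV. Poly_Mapping.lookup m (i, j)) = a i)"

lemma mhom_imp_multiforms:
  assumes "mhom a F" "\<And>i. i \<ge> s \<Longrightarrow> a i = 0"
  shows "F \<in> multiforms s"
  using assms unfolding multiforms_def mhom_def
  by (intro CollectI exI[of _ a]) (auto simp: not_less)

lemma mhom_0: "mhom a 0"
  by (simp add: mhom_def)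

lemma mhom_1: "mhom (\<lambda>_. 0) 1"
  by (simp add: mhom_def)

lemma mhom_add: "mhom a F \<Longrightarrow> mhom a G \<Longrightarrow> mhom a (F + G)"
  unfolding mhom_def using keys_add[of F G] by blast

lemma mhom_sum: "(\<And>x. x \<in> A \<Longrightarrow> mhom a (f x)) \<Longrightarrow> mhom a (sum f A)"
  by (induction A rule: infinite_finite_induct) (auto simp: mhom_0 mhom_add)

lemma mhom_mult:
  assumes "mhom a F" "mhom b G"
  shows "mhom (\<lambda>i. a i + b i) (F * G)"
  unfolding mhom_def
proof (intro ballI allI)
  fix m i assume "m \<in> Poly_Mapping.keys (F * G)"
  then obtain m1 m2 where "m = m1 + m2" "m1 \<in> Poly_Mapping.keys F" "m2 \<in> Poly_Mapping.keys G"
    using keys_mult[of F G] by blast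
  then show "(\<Sum>j\<in>UNIV. Poly_Mapping.lookup m (i, j)) = a i + b i"
    using assms by (simp add: mhom_def lookup_add sum.distrib)
qed

lemma mhom_prod:
  assumes "finite A" "\<And>x. x \<in> A \<Longrightarrow> mhom (a x) (f x)"
  shows "mhom (\<lambda>i. \<Sum>x\<in>A. a x i) (prod f A)"
  using assms by (induction A rule: finite_induct) (auto simp: mhom_1 intro: mhom_mult)

lemma mhom_uminus: "mhom a F \<Longrightarrow> mhom a (- F)"
  by (simp add: mhom_def in_keys_iff)

lemma multiforms_mult:
  assumes "F \<in> multiforms s" "G \<in> multiforms s"
  shows "F * G \<in> multiforms s"
proof -
  obtain a b where "mhom (\<lambda>i. if i < s then a i else 0) F" "mhom (\<lambda>i. if i < s then b i else 0) G"
    using assms unfolding multiforms_def mhom_def by blast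
  from mhom_mult[OF this] show ?thesis
    by (rule mhom_imp_multiforms) auto
qed

definition block_mono :: "nat \<Rightarrow> 'n::finite monomial \<Rightarrow> (nat \<times> 'n) monomial" where
  "block_mono i m = Abs_poly_mapping (\<lambda>(i', j). if i' = i then Poly_Mapping.lookup m j else 0)"

text \<open>The value of \<open>q\<close> at the \<open>i\<close>-th point, as a polynomial in the
  coordinates of all points.\<close>

definition block :: "nat \<Rightarrow> 'n::finite rpoly \<Rightarrow> (nat \<times> 'n) rpoly" where
  "block i q = (\<Sum>m\<in>Poly_Mapping.keys q.
     Poly_Mapping.single (block_mono i m) (Poly_Mapping.lookup q m))"

lemma lookup_block_mono:
  "Poly_Mapping.lookup (block_mono i m) (i', j) = (if i' = i then Poly_Mapping.lookup m j else 0)"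
proof -
  have "finite {x. (case x of (i', j) \<Rightarrow> if i' = i then Poly_Mapping.lookup m j else 0) \<noteq> 0}"
    by (rule finite_subset[of _ "{i} \<times> UNIV"]) (auto split: if_splits)
  then show ?thesis by (simp add: block_mono_def)
qed

lemma mono_eval_block_mono: "mono_eval (block_mono i m) a = mono_eval m (\<lambda>j. a (i, j))"
proof -
  have "Poly_Mapping.keys (block_mono i m) \<subseteq> Pair i ` UNIV"
    by (auto simp: in_keys_iff lookup_block_mono split: if_splits)
  then have "mono_eval (block_mono i m) a =
      (\<Prod>x\<in>Pair i ` UNIV. a x ^ Poly_Mapping.lookup (block_mono i m) x)"
    by (intro mono_eval_superset) auto
  also have "\<dots> = (\<Prod>j\<in>UNIV. a (i, j) ^ Poly_Mapping.lookup m j)"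
    by (subst prod.reindex) (auto simp: lookup_block_mono inj_on_def)
  finally show ?thesis by (simp add: mono_eval_superset[of UNIV])
qed

lemma peval_block: "peval (block i q) a = peval q (\<lambda>j. a (i, j))"
  by (simp add: block_def peval_sum mono_eval_block_mono peval_superset[of "Poly_Mapping.keys q"])

lemma mhom_block:
  assumes "q \<in> forms e"
  shows "mhom (\<lambda>k. if k = i then e else 0) (block i q)"
  unfolding block_def
proof (rule mhom_sum)
  fix m assume "m \<in> Poly_Mapping.keys q"
  then have "mdegree m = e" using assms by (simp add: forms_def)
  then show "mhom (\<lambda>k. if k = i then e else 0)
      (Poly_Mapping.single (block_mono i m) (Poly_Mapping.lookup q m))"
    by (simp add: mhom_def lookup_block_mono mdegree_superset[of UNIV])
qed

subsection \<open>General points impose independent conditions\<close>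

lemma det_nonzero_kernel:
  fixes c :: "nat \<Rightarrow> nat \<Rightarrow> real"
  assumes "det (mat k k (\<lambda>(i, j). c i j)) \<noteq> 0"
    and "\<And>i. i < k \<Longrightarrow> (\<Sum>j<k. c i j * u j) = 0" and "j < k"
  shows "u j = 0"
proof -
  let ?A = "mat k k (\<lambda>(i, j). c i j)"
  have "?A *\<^sub>v vec k u = 0\<^sub>v k"
    using assms(2) by (intro eq_vecI) (auto simp: scalar_prod_def atLeast0LessThan)
  then have "vec k u = 0\<^sub>v k"
    using assms(1) det_0_iff_vec_prod_zero_field[of ?A k] by (auto dest: spec[of _ "vec k u"])
  then show ?thesis using \<open>j < k\<close> by (metis index_vec index_zero_vec(1))
qed

text \<open>Interpolation, one point at a time. Below the full dimension some form \<open>p\<close>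
  lies outside the span of the \<open>q i\<close>; subtracting its interpolant leaves a nonzero form
  that vanishes at the old points, hence is nonzero at some new point \<open>x\<close>.\<close>

lemma dual_forms:
  assumes "k \<le> num_forms CARD('n::finite) e"
  shows "\<exists>(q :: nat \<Rightarrow> 'n rpoly) w. (\<forall>i<k. q i \<in> forms e) \<and>
    (\<forall>i<k. \<forall>j<k. peval (q i) (w j) = (if i = j then 1 else 0))"
  using assms
proof (induction k)
  case (Suc k)
  then have "k \<le> num_forms CARD('n) e" by simp
  then obtain q :: "nat \<Rightarrow> 'n rpoly" and w where *: "\<forall>i<k. q i \<in> forms e"
    "\<forall>i<k. \<forall>j<k. peval (q i) (w j) = (if i = j then 1 else 0)"
    using Suc.IH by blast
  note q = *(1)[rule_format] and w = *(2)[rule_format]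
  have "\<not> forms e \<subseteq> span (q ` {..<k})"
  proof
    assume "forms e \<subseteq> span (q ` {..<k})"
    then have "dim (forms e :: 'n rpoly set) \<le> card (q ` {..<k})" by (intro dim_le_card) auto
    also have "\<dots> \<le> k" using card_image_le[of "{..<k}" q] by simp
    finally show False using Suc.prems by (simp add: dim_forms)
  qed
  then obtain p where p: "p \<in> forms e" "p \<notin> span (q ` {..<k})" by auto
  define p' where "p' = p - (\<Sum>i<k. peval p (w i) *\<^sub>R q i)"
  have comb: "(\<Sum>i<k. peval p (w i) *\<^sub>R q i) \<in> span (q ` {..<k})"
    by (intro span_sum span_scale span_base) auto
  have p'_form: "p' \<in> forms e"
    unfolding p'_def using p q
    by (intro subspace_diff subspace_sum subspace_scale subspace_forms) auto
  have "p' \<noteq> 0" using p comb by (auto simp: p'_def)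
  then obtain x where x: "peval p' x \<noteq> 0" by (rule peval_nonzero)
  have p'_w: "peval p' (w j) = 0" if "j < k" for j
    using that by (simp add: p'_def peval_diff peval_sum w if_distrib cong: if_cong)
  define r where "r = inverse (peval p' x) *\<^sub>R p'"
  have r: "r \<in> forms e" "peval r x = 1" "\<And>j. j < k \<Longrightarrow> peval r (w j) = 0"
    using x p'_w p'_form by (auto simp: r_def intro: subspace_scale subspace_forms)
  \<comment> \<open>The old forms are corrected to vanish at \<open>x\<close>; since
    \<open>r\<close> vanishes at the old points, their values there do not change.\<close>
  let ?q = "\<lambda>i. if i < k then q i - peval (q i) x *\<^sub>R r else r"
  have "?q i \<in> forms e" if "i < Suc k" for i
    using q r by (auto intro!: subspace_diff subspace_scale subspace_forms)
  moreover have "peval (?q i) ((w(k := x)) j) = (if i = j then 1 else 0)"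
    if "i < Suc k" "j < Suc k" for i j
    using that w r by (auto simp: peval_diff less_Suc_eq)
  ultimately show ?case by (intro exI[of _ ?q] exI[of _ "w(k := x)"]) simp
qed auto

lemma finite_independent_forms:
  assumes "independent B" "B \<subseteq> (forms e :: 'n::finite rpoly set)"
  shows "finite B" "card B \<le> num_forms CARD('n) e"
proof -
  let ?S = "(\<lambda>m. Poly_Mapping.single m (1 :: real)) ` {m :: 'n monomial. mdegree m = e}"
  have "finite ?S" using card_monomials(1) by (rule finite_imageI)
  then have *: "finite B \<and> card B \<le> card ?S"
    using assms by (intro independent_span_bound) (simp_all add: forms_eq_span)
  show "finite B" using * by simp
  have "card ?S \<le> num_forms CARD('n) e"
    using card_image_le[OF card_monomials(1)] by (simp add: card_monomials)
  then show "card B \<le> num_forms CARD('n) e" using * by linarith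
qed

text \<open>The ring of polynomials has infinite dimension, and \<open>dim\<close> is 0 for a space
  with an infinite basis, so monotonicity has to be secured inside a single degree.\<close>

lemma dim_mono_forms:
  assumes "A \<subseteq> B" "B \<subseteq> (forms e :: 'n::finite rpoly set)"
  shows "dim A \<le> dim B"
proof -
  obtain C where C: "C \<subseteq> B" "independent C" "B \<subseteq> span C" "card C = dim B"
    by (rule basis_exists)
  have "finite C" using C assms by (intro finite_independent_forms(1)[of C e]) auto
  then have "dim A \<le> card C" using C assms by (intro dim_le_card) auto
  with C show ?thesis by simp
qed

text \<open>The \<open>q i\<close> are independent modulo the forms that vanish at the points:
  evaluating a relation at the \<open>v j\<close> removes the part from \<open>B\<close>, and the
  invertible evaluation matrix removes the rest.\<close>

lemma dim_forms_vanishing_le: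
  fixes q :: "nat \<Rightarrow> 'n::finite rpoly" and v :: "nat \<Rightarrow> 'n \<Rightarrow> real"
  assumes q: "\<And>i. i < k \<Longrightarrow> q i \<in> forms e"
    and det: "det (mat k k (\<lambda>(j, i). peval (q i) (v j))) \<noteq> 0"
  shows "dim {p \<in> forms e. \<forall>j<k. peval p (v j) = 0} + k \<le> num_forms CARD('n) e"
proof -
  let ?K = "{p \<in> forms e. \<forall>j<k. peval p (v j) = 0}"
  obtain B where B: "B \<subseteq> ?K" "independent B" "?K \<subseteq> span B" "card B = dim ?K"
    by (rule basis_exists)
  have fin: "finite B" using B by (intro finite_independent_forms(1)[of B e]) auto
  \<comment> \<open>A disjoint sum of index sets, since it is not known beforehand that the
    \<open>q i\<close> are distinct from each other and from the elements of
    \<open>B\<close>.\<close>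
  let ?I = "B <+> {..<k}" and ?b = "case_sum id q"
  have finI: "finite ?I" using fin by simp
  have zero: "u i = 0" if u: "(\<Sum>i\<in>?I. u i *\<^sub>R ?b i) = 0" and i: "i \<in> ?I" for u i
  proof -
    have *: "(\<Sum>x\<in>B. u (Inl x) *\<^sub>R x) + (\<Sum>i<k. u (Inr i) *\<^sub>R q i) = 0"
      using u fin by (simp add: sum.Plus)
    have q0: "u (Inr i) = 0" if "i < k" for i
    proof (rule det_nonzero_kernel[OF det _ that])
      fix j assume j: "j < k"
      have "0 = peval ((\<Sum>x\<in>B. u (Inl x) *\<^sub>R x) + (\<Sum>i<k. u (Inr i) *\<^sub>R q i)) (v j)"
        using * by simp
      also have "\<dots> = (\<Sum>x\<in>B. u (Inl x) * peval x (v j)) + (\<Sum>i<k. u (Inr i) * peval (q i) (v j))"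
        by (simp add: peval_add peval_sum)
      also have "(\<Sum>x\<in>B. u (Inl x) * peval x (v j)) = 0"
        using B(1) j by (intro sum.neutral) auto
      finally show "(\<Sum>i<k. peval (q i) (v j) * u (Inr i)) = 0" by (simp add: mult.commute)
    qed
    then have "(\<Sum>x\<in>B. u (Inl x) *\<^sub>R x) = 0" using * by simp
    then have "u (Inl x) = 0" if "x \<in> B" for x
      using independentD[OF B(2) fin order_refl, of "\<lambda>x. u (Inl x)"] that by blast
    with q0 i show ?thesis by auto
  qed
  have indep: "independent (?b ` ?I)" and inj: "inj_on ?b ?I"
    by (rule independent_imageI[OF finI], rule zero, assumption+)+
  have "?b ` ?I \<subseteq> forms e" using B(1) q by auto
  then have "card (?b ` ?I) \<le> num_forms CARD('n) e"
    by (rule finite_independent_forms(2)[OF indep])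
  then show ?thesis using card_image[OF inj] fin B(4) by (simp add: card_Plus)
qed

text \<open>\<open>G\<close> is the determinant of the evaluation matrix of the forms from
  \<open>dual_forms\<close>, with the points as variables; at the dual points it equals 1. Row
  \<open>j\<close> involves only the coordinates of point \<open>j\<close>, so every term of the
  Leibniz expansion has degree \<open>e\<close> in each of the first \<open>k\<close> blocks and
  degree 0 in the others.\<close>

lemma general_points_impose_conditions:
  assumes "k \<le> num_forms CARD('n::finite) e"
  obtains G :: "(nat \<times> 'n::finite) rpoly" and u where "mhom (\<lambda>i. if i < k then e else 0) G"
    and "peval G u \<noteq> 0"
    and "\<And>v. peval G v \<noteq> 0 \<Longrightarrow>
      dim {p \<in> forms e. \<forall>j<k. peval p (\<lambda>i. v (j, i)) = 0} + k \<le> num_forms CARD('n) e"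
proof -
  obtain q :: "nat \<Rightarrow> 'n rpoly" and w where q: "\<And>i. i < k \<Longrightarrow> q i \<in> forms e"
    and w: "\<And>i j. i < k \<Longrightarrow> j < k \<Longrightarrow> peval (q i) (w j) = (if i = j then 1 else 0)"
    using dual_forms[OF assms] by blast
  define M where "M = mat k k (\<lambda>(j, i). block j (q i))"
  have eval: "peval (det M) v = det (mat k k (\<lambda>(j, i). peval (q i) (\<lambda>l. v (j, l))))" for v
  proof -
    have "map_mat (\<lambda>p. peval p v) M = mat k k (\<lambda>(j, i). peval (q i) (\<lambda>l. v (j, l)))"
      by (rule eq_matI) (auto simp: M_def peval_block)
    then show ?thesis by (simp add: peval_det)
  qed
  show thesis
  proof (rule that[of "det M" "\<lambda>(j, l). w j l"])
    have "mat k k (\<lambda>(j, i). peval (q i) (w j)) = 1\<^sub>m k"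
      by (rule eq_matI) (auto simp: w)
    then show "peval (det M) (\<lambda>(j, l). w j l) \<noteq> 0" by (simp add: eval)
    show "dim {p \<in> forms e. \<forall>j<k. peval p (\<lambda>i. v (j, i)) = 0} + k \<le> num_forms CARD('n) e"
      if "peval (det M) v \<noteq> 0" for v
      by (rule dim_forms_vanishing_le[OF q]) (use that in \<open>simp_all add: eval\<close>)
    have "M \<in> carrier_mat k k" by (simp add: M_def)
    note det_def'[OF this]
    moreover have "mhom (\<lambda>i. if i < k then e else 0) (signof \<pi> * (\<Prod>j = 0..<k. M $$ (j, \<pi> j)))"
      if \<pi>: "\<pi> permutes {0..<k}" for \<pi>
    proof -
      have "M $$ (j, \<pi> j) = block j (q (\<pi> j))" if "j < k" for j
        using that permutes_in_image[OF \<pi>, of j] by (simp add: M_def)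
      then have "mhom (\<lambda>i. if i = j then e else 0) (M $$ (j, \<pi> j))" if "j \<in> {0..<k}" for j
        using that permutes_in_image[OF \<pi>, of j] by (simp add: mhom_block q)
      then have "mhom (\<lambda>i. \<Sum>j = 0..<k. if i = j then e else 0) (\<Prod>j = 0..<k. M $$ (j, \<pi> j))"
        by (intro mhom_prod) auto
      moreover have "(\<lambda>i. \<Sum>j = 0..<k. if i = j then e else 0) = (\<lambda>i. if i < k then e else 0)"
        by (auto simp: sum.delta')
      ultimately have "mhom (\<lambda>i. if i < k then e else 0) (\<Prod>j = 0..<k. M $$ (j, \<pi> j))" by simp
      then show ?thesis by (auto simp: sign_def intro: mhom_uminus)
    qed
    ultimately show "mhom (\<lambda>i. if i < k then e else 0) (det M)"
      by (auto intro!: mhom_sum)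
  qed
qed

subsection \<open>General sets of points\<close>

text \<open>The basic open set of \<open>F\<close>. One representative with nonzero value is asked
  for, because the representatives of a point include the zero vector.\<close>

definition nonvanishing_locus ::
    "nat \<Rightarrow> (nat \<times> 'n::finite) rpoly \<Rightarrow> (nat \<Rightarrow> (real ^ 'n) set) set" where
  "nonvanishing_locus s F = {z \<in> proj_tuples s.
     \<exists>v :: nat \<Rightarrow> real ^ 'n. (\<forall>i<s. v i \<in> z i) \<and> peval F (\<lambda>(i, j). vec_nth (v i) j) \<noteq> 0}"

lemma zariski_open_nonvanishing_locus:
  assumes "F \<in> multiforms s"
  shows "zariski_open s (nonvanishing_locus s F)"
  unfolding zariski_open_def zariski_closed_def
  by (rule conjI, force simp: nonvanishing_locus_def, rule exI[of _ "{F}"])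
    (use assms in \<open>auto simp: nonvanishing_locus_def\<close>)

lemma ex_proj_space:
  fixes v :: "real ^ 'n::finite"
  obtains L where "L \<in> proj_space" "v \<in> L"
proof -
  \<comment> \<open>A point where \<open>F\<close> does not vanish may have a zero block; the zero
    vector lies on every line, and a coordinate axis is taken.\<close>
  define w where "w = (if v = 0 then axis undefined 1 else v)"
  have "w \<noteq> 0" by (simp add: w_def axis_eq_0_iff)
  then have "span {w} \<in> proj_space" by (simp add: proj_space_def)
  moreover have "v \<in> span {w}" by (auto simp: w_def span_base span_zero)
  ultimately show ?thesis using that by blast
qed

lemma nonvanishing_locus_nonempty:
  fixes F :: "(nat \<times> 'n::finite) rpoly"
  assumes "peval F u \<noteq> 0"
  shows "nonvanishing_locus s F \<noteq> {}"
proof -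
  define v :: "nat \<Rightarrow> real ^ 'n" where "v i = (\<chi> j. u (i, j))" for i
  have u: "(\<lambda>(i, j). vec_nth (v i) j) = u" by (auto simp: v_def)
  have "\<exists>L. \<forall>i. L i \<in> proj_space \<and> v i \<in> L i"
    by (intro choice allI) (use ex_proj_space in blast)
  then obtain L where L: "\<And>i. L i \<in> proj_space" "\<And>i. v i \<in> L i" by blast
  have "restrict L {..<s} \<in> nonvanishing_locus s F"
    unfolding nonvanishing_locus_def proj_tuples_def
    using L assms u by (intro CollectI conjI exI[of _ v]) auto
  then show ?thesis by blast
qed

text \<open>A point of \<open>U\<close> violates one equation \<open>F\<close> of the closed
  complement, and then all of the nonvanishing locus of this \<open>F\<close> avoids the
  complement.\<close>

lemma zariski_open_contains_nonvanishing_locus: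
  fixes U :: "(nat \<Rightarrow> (real ^ 'n::finite) set) set"
  assumes "zariski_open s U" "U \<noteq> {}"
  obtains F u where "F \<in> multiforms s" "peval F u \<noteq> 0" "nonvanishing_locus s F \<subseteq> U"
proof -
  obtain \<F> where \<F>: "\<F> \<subseteq> multiforms s"
    and U: "U \<subseteq> proj_tuples s" "proj_tuples s - U = {z \<in> proj_tuples s. \<forall>F\<in>\<F>. \<forall>v :: nat \<Rightarrow> real ^ 'n.
            (\<forall>i<s. v i \<in> z i) \<longrightarrow> peval F (\<lambda>(i, j). vec_nth (v i) j) = 0}"
    using assms unfolding zariski_open_def zariski_closed_def by blast
  obtain z where z: "z \<in> U" using assms by blast
  then have "z \<in> proj_tuples s" "z \<notin> proj_tuples s - U" using U(1) by blast+
  then have "\<not> (\<forall>F\<in>\<F>. \<forall>v :: nat \<Rightarrow> real ^ 'n.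
      (\<forall>i<s. v i \<in> z i) \<longrightarrow> peval F (\<lambda>(i, j). vec_nth (v i) j) = 0)"
    unfolding U(2) by blast
  then obtain F and v :: "nat \<Rightarrow> real ^ 'n" where F: "F \<in> \<F>"
    "peval F (\<lambda>(i, j). vec_nth (v i) j) \<noteq> 0"
    by blast
  have "z' \<in> U" if "z' \<in> nonvanishing_locus s F" for z'
  proof -
    have "z' \<in> proj_tuples s" "z' \<notin> proj_tuples s - U"
      using that F(1) unfolding U(2) nonvanishing_locus_def by blast+
    then show ?thesis by blast
  qed
  with F \<F> that show thesis by blast
qed

lemma nonvanishing_locus_mult:
  "nonvanishing_locus s (F * G) \<subseteq> nonvanishing_locus s F \<inter> nonvanishing_locus s G"
  by (auto simp: nonvanishing_locus_def peval_mult)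

definition forms_through :: "nat \<Rightarrow> (real ^ 'n::finite) set set \<Rightarrow> 'n rpoly set" where
  "forms_through e Z = {p \<in> forms e. vanishes_on p Z}"

text \<open>Adds one dimension bound to a general property and can be iterated. The first
  \<open>k\<close> points already give the bound, as further points only shrink the space of forms.
  It is applied with all \<open>s\<close> points in degree \<open>d\<close> and with N_{d-1} of them
  in degree \<open>d - 1\<close>.\<close>

lemma for_general_points_conj_dim:
  fixes P :: "(real ^ 'n::finite) set set \<Rightarrow> bool"
  assumes P: "for_general_points s P" and k: "k \<le> s" "k \<le> num_forms CARD('n) e"
  shows "for_general_points s (\<lambda>Z. P Z \<and> dim (forms_through e Z) + k \<le> num_forms CARD('n) e)"
proof -
  obtain U where U: "zariski_open s U" "U \<noteq> {}" "\<And>z. z \<in> U \<Longrightarrow> P (z ` {..<s})"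
    using P unfolding for_general_points_def by blast
  obtain F u where F: "F \<in> multiforms s" "peval F u \<noteq> 0" "nonvanishing_locus s F \<subseteq> U"
    using zariski_open_contains_nonvanishing_locus[OF U(1,2)] .
  obtain G :: "(nat \<times> 'n) rpoly" and w where G: "mhom (\<lambda>i. if i < k then e else 0) G"
    "peval G w \<noteq> 0" "\<And>v. peval G v \<noteq> 0 \<Longrightarrow>
      dim {p \<in> forms e. \<forall>j<k. peval p (\<lambda>i. v (j, i)) = 0} + k \<le> num_forms CARD('n) e"
    by (rule general_points_impose_conditions[OF k(2)]) blast
  have "G \<in> multiforms s" by (rule mhom_imp_multiforms[OF G(1)]) (use k in auto)
  with F(1) have FG: "F * G \<in> multiforms s" by (rule multiforms_mult)
  obtain x where x: "peval (F * G) x \<noteq> 0"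
    using common_nonvanishing[OF F(2) G(2)] by (auto simp: peval_mult)
  show ?thesis
    unfolding for_general_points_def
  proof (intro exI[of _ "nonvanishing_locus s (F * G)"] conjI ballI)
    show "zariski_open s (nonvanishing_locus s (F * G))"
      by (rule zariski_open_nonvanishing_locus[OF FG])
    show "nonvanishing_locus s (F * G) \<noteq> {}"
      by (rule nonvanishing_locus_nonempty[OF x])
    fix z assume z: "z \<in> nonvanishing_locus s (F * G)"
    then show "P (z ` {..<s})" using nonvanishing_locus_mult F(3) U(3) by blast
    from z obtain v :: "nat \<Rightarrow> real ^ 'n" where v: "\<And>i. i < s \<Longrightarrow> v i \<in> z i"
      "peval G (\<lambda>(i, j). vec_nth (v i) j) \<noteq> 0"
      by (auto simp: nonvanishing_locus_def peval_mult)
    have "forms_through e (z ` {..<s}) \<subseteq> {p \<in> forms e. \<forall>j<k. peval p (vec_nth (v j)) = 0}"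
      using v(1) order.strict_trans2[OF _ k(1)] by (fastforce simp: forms_through_def vanishes_on_def)
    then have "dim (forms_through e (z ` {..<s})) \<le> dim {p \<in> forms e. \<forall>j<k. peval p (vec_nth (v j)) = 0}"
      by (rule dim_mono_forms[where e = e]) auto
    then show "dim (forms_through e (z ` {..<s})) + k \<le> num_forms CARD('n) e"
      using G(3)[OF v(2)] by simp
  qed
qed

subsection \<open>Homogeneous components\<close>

definition hcomponent :: "nat \<Rightarrow> 'v rpoly \<Rightarrow> 'v rpoly" where
  "hcomponent e p = (\<Sum>m\<in>{m \<in> Poly_Mapping.keys p. mdegree m = e}.
     Poly_Mapping.single m (Poly_Mapping.lookup p m))"

lemma lookup_hcomponent:
  "Poly_Mapping.lookup (hcomponent e p) m = (if mdegree m = e then Poly_Mapping.lookup p m else 0)"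
  by (auto simp: hcomponent_def lookup_sum lookup_single when_def in_keys_iff)

lemma hcomponent_add: "hcomponent e (p + q) = hcomponent e p + hcomponent e q"
  by (rule poly_mapping_eqI) (simp add: lookup_hcomponent lookup_add)

lemma hcomponent_0 [simp]: "hcomponent e 0 = 0"
  by (rule poly_mapping_eqI) (simp add: lookup_hcomponent)

lemma hcomponent_in_forms: "hcomponent e p \<in> forms e"
  by (auto simp: forms_def in_keys_iff lookup_hcomponent split: if_splits)

lemma hcomponent_form: "p \<in> forms e \<Longrightarrow> hcomponent e p = p"
  by (rule poly_mapping_eqI) (auto simp: lookup_hcomponent forms_def in_keys_iff)

lemma hcomponent_eq_0: "(\<And>m. m \<in> Poly_Mapping.keys p \<Longrightarrow> mdegree m \<noteq> e) \<Longrightarrow> hcomponent e p = 0"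
  by (rule poly_mapping_eqI) (auto simp: lookup_hcomponent in_keys_iff)

text \<open>Filtration by order at the origin. Elements of an ideal hull need not be homogeneous,
  and their lowest component is what behaves well under multiplication.\<close>

definition order_ge :: "nat \<Rightarrow> 'v rpoly \<Rightarrow> bool" where
  "order_ge e p \<longleftrightarrow> (\<forall>m\<in>Poly_Mapping.keys p. e \<le> mdegree m)"

lemma order_ge_mult:
  assumes "order_ge a p" "order_ge b q"
  shows "order_ge (a + b) (p * q)"
  unfolding order_ge_def
proof
  fix m assume "m \<in> Poly_Mapping.keys (p * q)"
  then obtain m1 m2 where "m = m1 + m2" "m1 \<in> Poly_Mapping.keys p" "m2 \<in> Poly_Mapping.keys q"
    using keys_mult[of p q] by blast
  then show "a + b \<le> mdegree m"
    using assms by (auto simp: order_ge_def mdegree_add intro: add_mono)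
qed

lemma order_ge_add: "order_ge a p \<Longrightarrow> order_ge a q \<Longrightarrow> order_ge a (p + q)"
  unfolding order_ge_def using keys_add[of p q] by blast

lemma order_ge_minus_hcomponent:
  assumes "order_ge a p"
  shows "order_ge (Suc a) (p - hcomponent a p)"
  unfolding order_ge_def
proof
  fix m assume "m \<in> Poly_Mapping.keys (p - hcomponent a p)"
  then have "m \<in> Poly_Mapping.keys p" "mdegree m \<noteq> a"
    by (auto simp: in_keys_iff lookup_minus lookup_hcomponent split: if_splits)
  then show "Suc a \<le> mdegree m" using assms by (auto simp: order_ge_def Suc_le_eq le_less)
qed

lemma order_ge_form: "p \<in> forms e \<Longrightarrow> order_ge e p"
  by (simp add: forms_def order_ge_def)

text \<open>Lowest components multiply: all other contributions to the product have degree greater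
  than \<open>a + b\<close>.\<close>

lemma hcomponent_mult:
  assumes "order_ge a p" "order_ge b q"
  shows "hcomponent (a + b) (p * q) = hcomponent a p * hcomponent b q"
proof -
  let ?p = "p - hcomponent a p" and ?q = "q - hcomponent b q"
  have eq: "p * q = hcomponent a p * hcomponent b q + (hcomponent a p * ?q + ?p * q)"
    by (simp add: algebra_simps)
  have "order_ge (Suc (a + b)) (hcomponent a p * ?q)"
    using order_ge_mult[OF order_ge_form[OF hcomponent_in_forms] order_ge_minus_hcomponent[OF assms(2)], of a p]
    by simp
  moreover have "order_ge (Suc (a + b)) (?p * q)"
    using order_ge_mult[OF order_ge_minus_hcomponent[OF assms(1)] assms(2)] by simp
  ultimately have "order_ge (Suc (a + b)) (hcomponent a p * ?q + ?p * q)"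
    by (rule order_ge_add)
  then have "hcomponent (a + b) (hcomponent a p * ?q + ?p * q) = 0"
    by (intro hcomponent_eq_0) (auto simp: order_ge_def)
  moreover have "hcomponent (a + b) (hcomponent a p * hcomponent b q) = hcomponent a p * hcomponent b q"
    by (intro hcomponent_form forms_mult hcomponent_in_forms)
  ultimately show ?thesis
    by (subst eq) (simp only: hcomponent_add add_0_right)
qed

lemma hcomponent_0_eq: "hcomponent 0 p = Poly_Mapping.single 0 (Poly_Mapping.lookup p 0)"
  by (rule poly_mapping_eqI) (auto simp: lookup_hcomponent lookup_single when_def mdegree_eq_0_iff)

text \<open>Supplies the ideals by which hulls are bounded from above. A multiplier acts on the
  component of degree \<open>e\<close> through its constant term alone, so a linear subspace
  \<open>V\<close> is stable enough.\<close>

lemma is_ideal_order_ge_hcomponent: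
  fixes V :: "'a rpoly set"
  assumes "subspace V"
  shows "is_ideal {f. order_ge e f \<and> hcomponent e f \<in> V}"
  unfolding is_ideal_def
proof (intro conjI ballI allI)
  show "0 \<in> {f. order_ge e f \<and> hcomponent e f \<in> V}"
    using assms by (simp add: order_ge_def subspace_0)
next
  fix f g assume "f \<in> {f. order_ge e f \<and> hcomponent e f \<in> V}" "g \<in> {f. order_ge e f \<and> hcomponent e f \<in> V}"
  then show "f + g \<in> {f. order_ge e f \<and> hcomponent e f \<in> V}"
    using assms by (simp add: order_ge_add hcomponent_add subspace_add)
next
  fix a f :: "'a rpoly" assume f: "f \<in> {f. order_ge e f \<and> hcomponent e f \<in> V}"
  have "order_ge 0 a" by (simp add: order_ge_def)
  with f have "order_ge (0 + e) (a * f)"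
    and "hcomponent (0 + e) (a * f) = Poly_Mapping.lookup a 0 *\<^sub>R hcomponent e f"
    using order_ge_mult[of 0 a e f] hcomponent_mult[of 0 a e f]
    by (simp_all add: hcomponent_0_eq scaleR_rpoly)
  with f assms show "a * f \<in> {f. order_ge e f \<and> hcomponent e f \<in> V}"
    by (simp add: subspace_scale)
qed

subsection \<open>The square of the vanishing ideal in degree $2d$\<close>

lemma subspace_forms_through: "subspace (forms_through e Z)"
  using subspace_forms[of e]
  by (auto simp: subspace_def forms_through_def vanishes_on_def peval_add)

lemma dim_forms_zero:
  assumes "V \<subseteq> (forms e :: 'n::finite rpoly set)" "dim V = 0"
  shows "V \<subseteq> {0}"
proof -
  obtain B where B: "B \<subseteq> V" "independent B" "V \<subseteq> span B" "card B = dim V"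
    by (rule basis_exists)
  have "finite B" using B assms by (intro finite_independent_forms(1)[of B e]) auto
  then have "B = {}" using B assms by simp
  then show ?thesis using B by simp
qed

lemma single_mult_eq_0:
  fixes p :: "'v rpoly"
  assumes "Poly_Mapping.single m 1 * p = 0"
  shows "p = 0"
proof (rule poly_mapping_eqI)
  fix k
  have "Poly_Mapping.single m 1 * p =
      (\<Sum>l\<in>Poly_Mapping.keys p. Poly_Mapping.single (m + l) (Poly_Mapping.lookup p l))"
    using arg_cong[OF poly_mapping_sum_single[of p], of "(*) (Poly_Mapping.single m 1)"]
    by (simp add: sum_distrib_left mult_single)
  then have "0 = Poly_Mapping.lookup
      (\<Sum>l\<in>Poly_Mapping.keys p. Poly_Mapping.single (m + l) (Poly_Mapping.lookup p l)) (m + k)"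
    using assms by simp
  also have "\<dots> = Poly_Mapping.lookup p k"
    by (auto simp: lookup_sum lookup_single when_def in_keys_iff)
  finally show "Poly_Mapping.lookup p k = Poly_Mapping.lookup 0 k" by simp
qed

text \<open>Multiplication by a power of any one variable raises the degree, keeps the zeros and is
  injective.\<close>

lemma forms_through_lower_degree:
  fixes Z :: "(real ^ 'n::finite) set set"
  assumes "forms_through e Z \<subseteq> {0}" "e' \<le> e"
  shows "forms_through e' Z \<subseteq> {0}"
proof
  fix f assume f: "f \<in> forms_through e' Z"
  define m :: "'n monomial" where "m = Poly_Mapping.single undefined (e - e')"
  have "Poly_Mapping.single m (1 :: real) \<in> forms (e - e')" by (simp add: forms_def m_def)
  then have "Poly_Mapping.single m 1 * f \<in> forms e"
    using forms_mult[of "Poly_Mapping.single m 1" "e - e'" f e'] f assms(2)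
    by (simp add: forms_through_def)
  then have "Poly_Mapping.single m 1 * f \<in> forms_through e Z"
    using f by (simp add: forms_through_def vanishes_on_def peval_mult)
  then have "Poly_Mapping.single m 1 * f = 0" using assms(1) by blast
  then show "f \<in> {0}" using single_mult_eq_0 by blast
qed

lemma vanishing_ideal_subset:
  fixes Z :: "(real ^ 'n::finite) set set"
  assumes "d \<ge> 1" "forms_through (d - 1) Z \<subseteq> {0}"
  shows "vanishing_ideal Z \<subseteq> {f. order_ge d f \<and> hcomponent d f \<in> forms_through d Z}"
  unfolding vanishing_ideal_def
proof (rule hull_minimal)
  show "is_ideal {f. order_ge d f \<and> hcomponent d f \<in> forms_through d Z}"
    by (rule is_ideal_order_ge_hcomponent[OF subspace_forms_through])
  show "{f. (\<exists>e. f \<in> forms e) \<and> vanishes_on f Z}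
      \<subseteq> {f. order_ge d f \<and> hcomponent d f \<in> forms_through d Z}"
  proof safe
    fix f e assume f: "f \<in> forms e" "vanishes_on f Z"
    have fe: "f \<in> forms_through e Z" using f by (simp add: forms_through_def)
    have z: "0 \<in> forms_through d Z" by (rule subspace_0[OF subspace_forms_through])
    consider "e < d" | "e = d" | "e > d" by linarith
    then have "order_ge d f \<and> hcomponent d f \<in> forms_through d Z"
    proof cases
      case 1
      then have "f = 0" using forms_through_lower_degree[OF assms(2), of e] fe by fastforce
      then show ?thesis using z by (simp add: order_ge_def)
    next
      case 2
      then show ?thesis using fe f by (simp add: hcomponent_form order_ge_form)
    next
      case 3
      then have "hcomponent d f = 0" using f by (intro hcomponent_eq_0) (auto simp: forms_def)
      then show ?thesis using z f 3 by (auto simp: order_ge_def forms_def)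
    qed
    then show "order_ge d f" "hcomponent d f \<in> forms_through d Z" by auto
  qed
qed

text \<open>Both factors have order at least \<open>d\<close>, so the component of degree
  \<open>2 * d\<close> of their product is the product of their components of degree
  \<open>d\<close>.\<close>

lemma ideal_square_degree_2d:
  fixes Z :: "(real ^ 'n::finite) set set"
  assumes "d \<ge> 1" "forms_through (d - 1) Z \<subseteq> {0}"
  shows "ideal_mult (vanishing_ideal Z) (vanishing_ideal Z) \<inter> forms (2 * d)
    \<subseteq> span {p * q | p q. p \<in> forms_through d Z \<and> q \<in> forms_through d Z}" (is "_ \<subseteq> span ?S")
proof -
  let ?J = "{f. order_ge (2 * d) f \<and> hcomponent (2 * d) f \<in> span ?S}"
  have "ideal_mult (vanishing_ideal Z) (vanishing_ideal Z) \<subseteq> ?J"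
    unfolding ideal_mult_def
  proof (rule hull_minimal)
    show "is_ideal ?J" by (rule is_ideal_order_ge_hcomponent[OF subspace_span])
    show "{f * g |f g. f \<in> vanishing_ideal Z \<and> g \<in> vanishing_ideal Z} \<subseteq> ?J"
    proof clarify
      fix f g assume "f \<in> vanishing_ideal Z" "g \<in> vanishing_ideal Z"
      then have *: "order_ge d f" "hcomponent d f \<in> forms_through d Z"
        "order_ge d g" "hcomponent d g \<in> forms_through d Z"
        using vanishing_ideal_subset[OF assms] by auto
      then show "order_ge (2 * d) (f * g) \<and> hcomponent (2 * d) (f * g) \<in> span ?S"
        unfolding mult_2
        by (auto simp: hcomponent_mult intro: order_ge_mult intro!: span_base)
    qed
  qed
  then show ?thesis using hcomponent_form by fastforce
qed

lemma hilbert_fun_bound: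
  fixes I :: "'n::finite rpoly set"
  assumes I: "I \<inter> forms e \<subseteq> span S" and S: "S \<subseteq> forms e"
  shows "num_forms CARD('n) e \<le> hilbert_fun e I + dim S"
proof -
  let ?F = "forms e :: 'n rpoly set" and ?P = "\<lambda>k B. B \<subseteq> forms e \<and> finite B \<and> card B = k \<and>
    forms e \<subseteq> span (B \<union> (I \<inter> forms e))"
  obtain B0 where B0: "B0 \<subseteq> ?F" "independent B0" "?F \<subseteq> span B0" "card B0 = dim ?F"
    by (rule basis_exists)
  have "finite B0" using B0(2,1) by (rule finite_independent_forms(1))
  \<comment> \<open>A basis of all forms is a spanning set of the quotient; such a witness is what
    gives the \<open>LEAST\<close> in \<open>quotient_dim\<close> its meaning.\<close>
  then have "\<exists>k B. ?P k B"
    using B0 span_mono[of B0 "B0 \<union> (I \<inter> forms e)"] by blast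
  then have "\<exists>B. ?P (LEAST k. \<exists>B. ?P k B) B" by (rule LeastI_ex)
  then obtain B where B: "?P (hilbert_fun e I) B"
    unfolding hilbert_fun_def quotient_dim_def by blast
  obtain C where C: "C \<subseteq> S" "independent C" "S \<subseteq> span C" "card C = dim S"
    by (rule basis_exists)
  have finC: "finite C" using C S by (intro finite_independent_forms(1)[of C e]) auto
  have "span S \<subseteq> span (B \<union> C)"
    using C(3) span_mono[of C "B \<union> C"] by (intro span_minimal subspace_span) auto
  then have "B \<union> (I \<inter> forms e) \<subseteq> span (B \<union> C)"
    using I span_superset[of "B \<union> C"] by blast
  then have "span (B \<union> (I \<inter> forms e)) \<subseteq> span (B \<union> C)"
    by (intro span_minimal subspace_span)
  then have "forms e \<subseteq> span (B \<union> C)" using B by blast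
  then have "dim ?F \<le> card (B \<union> C)" using B finC by (intro dim_le_card) auto
  also have "\<dots> \<le> card B + card C" by (rule card_Un_le)
  finally show ?thesis using B C by (simp add: dim_forms)
qed

text \<open>The coefficients are indexed by \<open>I\<close> instead of the image, so that they can
  serve as rows of a matrix.\<close>

lemma span_family:
  assumes "finite I" "p \<in> span (b ` I)"
  obtains u where "p = (\<Sum>i\<in>I. u i *\<^sub>R b i)"
proof -
  have "span (b ` I) \<subseteq> {\<Sum>i\<in>I. u i *\<^sub>R b i | u. True}"
  proof (rule span_minimal)
    show "b ` I \<subseteq> {\<Sum>i\<in>I. u i *\<^sub>R b i | u. True}"
    proof clarify
      fix j assume "j \<in> I"
      then have "b j = (\<Sum>i\<in>I. (if i = j then 1 else 0) *\<^sub>R b i)"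
        using assms(1) by (simp add: if_distrib[of "\<lambda>c. c *\<^sub>R _"] cong: if_cong)
      then show "\<exists>u. b j = (\<Sum>i\<in>I. u i *\<^sub>R b i) \<and> True"
        by (intro exI[of _ "\<lambda>i. if i = j then 1 else 0"]) simp
    qed
    show "subspace {\<Sum>i\<in>I. u i *\<^sub>R b i | u. True}"
    proof (rule subspaceI)
      show "0 \<in> {\<Sum>i\<in>I. u i *\<^sub>R b i | u. True}" by (intro CollectI exI[of _ "\<lambda>_. 0"]) simp
    next
      fix x y assume "x \<in> {\<Sum>i\<in>I. u i *\<^sub>R b i | u. True}" "y \<in> {\<Sum>i\<in>I. u i *\<^sub>R b i | u. True}"
      then obtain u v where "x = (\<Sum>i\<in>I. u i *\<^sub>R b i)" "y = (\<Sum>i\<in>I. v i *\<^sub>R b i)" by blast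
      then have "x + y = (\<Sum>i\<in>I. (u i + v i) *\<^sub>R b i)" by (simp add: scaleR_add_left sum.distrib)
      then show "x + y \<in> {\<Sum>i\<in>I. u i *\<^sub>R b i | u. True}"
        by (intro CollectI exI[of _ "\<lambda>i. u i + v i"]) simp
    next
      fix c x assume "x \<in> {\<Sum>i\<in>I. u i *\<^sub>R b i | u. True}"
      then obtain u where "x = (\<Sum>i\<in>I. u i *\<^sub>R b i)" by blast
      then have "c *\<^sub>R x = (\<Sum>i\<in>I. (c * u i) *\<^sub>R b i)" by (simp add: scaleR_sum_right)
      then show "c *\<^sub>R x \<in> {\<Sum>i\<in>I. u i *\<^sub>R b i | u. True}"
        by (intro CollectI exI[of _ "\<lambda>i. c * u i"]) simp
    qed
  qed
  then show ?thesis using assms(2) that by blast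
qed

text \<open>One representative of each unordered pair, the larger index standing first, because
  multiplication is commutative.\<close>

definition index_pairs :: "nat \<Rightarrow> (nat \<times> nat) set" where
  "index_pairs t = (SIGMA j:{..<t}. {..j})"

lemma finite_index_pairs [simp]: "finite (index_pairs t)"
  by (simp add: index_pairs_def)

lemma card_index_pairs: "2 * card (index_pairs t) = t * (t + 1)"
proof -
  have "card (index_pairs t) = (\<Sum>j<t. Suc j)" by (simp add: index_pairs_def)
  moreover have "2 * (\<Sum>j<t. Suc j) = t * (t + 1)" by (induction t) simp_all
  ultimately show ?thesis by simp
qed

lemma products_in_span_index_pairs:
  fixes b :: "nat \<Rightarrow> 'v rpoly"
  assumes p: "p \<in> span (b ` {..<t})" and q: "q \<in> span (b ` {..<t})"
  shows "p * q \<in> span ((\<lambda>(j, i). b j * b i) ` index_pairs t)"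
proof -
  obtain u where u: "p = (\<Sum>i<t. u i *\<^sub>R b i)" using span_family[OF _ p] by auto
  obtain v where v: "q = (\<Sum>i<t. v i *\<^sub>R b i)" using span_family[OF _ q] by auto
  have "b i * b j \<in> (\<lambda>(j, i). b j * b i) ` index_pairs t" if "i < t" "j < t" for i j
  proof (cases "i \<le> j")
    case True
    then show ?thesis using that
      by (intro image_eqI[of _ _ "(j, i)"]) (auto simp: index_pairs_def mult.commute)
  next
    case False
    then show ?thesis using that by (intro image_eqI[of _ _ "(i, j)"]) (auto simp: index_pairs_def)
  qed
  then show ?thesis
    unfolding u v sum_product scaleR_mult_rpoly
    by (intro span_sum span_scale span_base) auto
qed

text \<open>The only place where the conjecture enters: its value of $h_{2d}(I^2)$ leaves no room for a
  linear relation between the products $b_jb_i$.\<close>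

lemma independent_products:
  fixes Z :: "(real ^ 'n::finite) set set"
  assumes d: "d \<ge> 1" "forms_through (d - 1) Z \<subseteq> {0}"
    and dim: "dim (forms_through d Z) \<le> \<tau>"
    and hilb: "2 * num_forms CARD('n) (2 * d) =
      2 * hilbert_fun (2 * d) (ideal_mult (vanishing_ideal Z) (vanishing_ideal Z)) + \<tau> * (\<tau> + 1)"
  obtains b :: "nat \<Rightarrow> 'n rpoly" where "\<And>i. i < \<tau> \<Longrightarrow> b i \<in> forms_through d Z"
    and "forms_through d Z \<subseteq> span (b ` {..<\<tau>})"
    and "\<And>u x. (\<Sum>x\<in>index_pairs \<tau>. u x *\<^sub>R (case x of (j, i) \<Rightarrow> b j * b i)) = 0 \<Longrightarrow>
      x \<in> index_pairs \<tau> \<Longrightarrow> u x = 0"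
proof -
  let ?V = "forms_through d Z"
  obtain B where B: "B \<subseteq> ?V" "independent B" "?V \<subseteq> span B" "card B = dim ?V"
    by (rule basis_exists)
  have "finite B"
    using B by (intro finite_independent_forms(1)[of B d]) (auto simp: forms_through_def)
  then obtain b where b: "bij_betw b {..<card B} B"
    using ex_bij_betw_nat_finite[of B] by (auto simp: atLeast0LessThan)
  define t where "t = card B"
  have im: "b ` {..<t} = B" using b by (simp add: t_def bij_betw_def)
  have bV: "b i \<in> ?V" if "i < t" for i using that im B(1) by auto
  let ?b = "\<lambda>x. case x of (j, i) \<Rightarrow> b j * b i"
  have "{p * q | p q. p \<in> ?V \<and> q \<in> ?V} \<subseteq> span (?b ` index_pairs t)"
    using B(3) products_in_span_index_pairs[where b = b and t = t] by (auto simp: im)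
  then have "span {p * q | p q. p \<in> ?V \<and> q \<in> ?V} \<subseteq> span (?b ` index_pairs t)"
    by (intro span_minimal subspace_span)
  with ideal_square_degree_2d[OF d]
  have "ideal_mult (vanishing_ideal Z) (vanishing_ideal Z) \<inter> forms (2 * d) \<subseteq> span (?b ` index_pairs t)"
    by blast
  moreover have "?b ` index_pairs t \<subseteq> forms (2 * d)"
    using bV by (auto simp: index_pairs_def forms_through_def mult_2 intro!: forms_mult)
  ultimately have "num_forms CARD('n) (2 * d) \<le>
      hilbert_fun (2 * d) (ideal_mult (vanishing_ideal Z) (vanishing_ideal Z)) + dim (?b ` index_pairs t)"
    by (rule hilbert_fun_bound)
  with hilb have ge: "\<tau> * (\<tau> + 1) \<le> 2 * dim (?b ` index_pairs t)" by simp
  have "dim (?b ` index_pairs t) \<le> card (?b ` index_pairs t)"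
    by (intro dim_le_card span_superset) simp
  also have "\<dots> \<le> card (index_pairs t)" by (rule card_image_le) simp
  finally have "\<tau> * (\<tau> + 1) \<le> t * (t + 1)" using ge card_index_pairs[of t] by linarith
  \<comment> \<open>Fewer than \<open>\<tau>\<close> forms have too few products, so the Hilbert
    function turns the bound on the dimension into an equality.\<close>
  moreover have "t * (t + 1) < \<tau> * (\<tau> + 1)" if "t < \<tau>"
    using that by (intro mult_strict_mono) auto
  ultimately have t: "t = \<tau>" using dim B(4) by (fastforce simp: t_def)
  show thesis
  proof (rule that[of b])
    show "b i \<in> ?V" if "i < \<tau>" for i using bV that t by simp
    show "?V \<subseteq> span (b ` {..<\<tau>})" using B(3) im t by simp
    show "u x = 0" if "(\<Sum>x\<in>index_pairs \<tau>. u x *\<^sub>R ?b x) = 0" "x \<in> index_pairs \<tau>" for u x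
    proof (rule family_scalars_zero[OF _ _ that])
      show "card (index_pairs \<tau>) \<le> dim (?b ` index_pairs \<tau>)" using ge t card_index_pairs[of \<tau>] by simp
    qed simp
  qed
qed

subsection \<open>Shortening sums of squares\<close>

lemma linear_relation:
  fixes p :: "nat \<Rightarrow> 'v rpoly"
  assumes "finite A" "\<And>k. k \<in> A \<Longrightarrow> p k \<in> span B" "finite B" "card B < card A"
  obtains u i where "i \<in> A" "u i \<noteq> 0" "(\<Sum>k\<in>A. u k *\<^sub>R p k) = 0"
proof (rule ccontr)
  assume "\<not> thesis"
  then have zero: "\<And>u i. (\<Sum>k\<in>A. u k *\<^sub>R p k) = 0 \<Longrightarrow> i \<in> A \<Longrightarrow> u i = 0"
    using that by blast
  have indep: "independent (p ` A)" and inj: "inj_on p A"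
    by (rule independent_imageI[OF assms(1)], rule zero, assumption+)+
  have "card (p ` A) \<le> card B"
    using independent_span_bound[OF assms(3) indep] assms(2) by blast
  then show False using assms(4) card_image[OF inj] by simp
qed

text \<open>If $P=\sum_k\mu_kp_k$ and $q_k=p_k+c\mu_kP$, then $\sum_kq_k^2=\sum_kp_k^2+(2c+c^2M)P^2$ with
  $M=\sum_k\mu_k^2$, and $c=1/(1+\sqrt{1+M})$ makes the bracket equal to $1$.\<close>

lemma absorb_square:
  fixes p :: "nat \<Rightarrow> 'v rpoly"
  assumes "finite A" "P = (\<Sum>k\<in>A. \<mu> k *\<^sub>R p k)"
  obtains c where "(\<Sum>k\<in>A. (p k + (c * \<mu> k) *\<^sub>R P)\<^sup>2) = (\<Sum>k\<in>A. (p k)\<^sup>2) + P\<^sup>2"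
proof
  define M where "M = (\<Sum>k\<in>A. (\<mu> k)\<^sup>2)"
  define w where "w = sqrt (1 + M)"
  define c where "c = 1 / (1 + w)"
  have "M \<ge> 0" by (simp add: M_def sum_nonneg)
  then have w: "w \<ge> 0" "M = w\<^sup>2 - 1" by (simp_all add: w_def)
  have "1 + w \<noteq> 0" using w by linarith
  then have "c * (1 + w) = 1" by (simp add: c_def)
  \<comment> \<open>Here c^2 M = c(1 + w) * c(w - 1), and c(w - 1) = c(1 + w) - 2c.\<close>
  moreover have "2 * c + c\<^sup>2 * M = 2 * c + (c * (1 + w)) * (c * (1 + w) - 2 * c)"
    unfolding w(2) by (simp add: power2_eq_square algebra_simps)
  ultimately have cM: "2 * c + c\<^sup>2 * M = 1" by simp
  have "(p k + (c * \<mu> k) *\<^sub>R P)\<^sup>2 = (p k)\<^sup>2 + (2 * c) *\<^sub>R ((\<mu> k *\<^sub>R p k) * P) + (c\<^sup>2 * (\<mu> k)\<^sup>2) *\<^sub>R P\<^sup>2" for k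
  proof -
    have "(p k + (c * \<mu> k) *\<^sub>R P)\<^sup>2 = (p k)\<^sup>2 + ((c * \<mu> k) *\<^sub>R (p k * P) + (c * \<mu> k) *\<^sub>R (p k * P))
        + ((c * \<mu> k) * (c * \<mu> k)) *\<^sub>R P\<^sup>2"
      by (simp add: power2_eq_square distrib_left distrib_right scaleR_mult_rpoly mult.commute add_ac)
    also have "(c * \<mu> k) *\<^sub>R (p k * P) + (c * \<mu> k) *\<^sub>R (p k * P) = (2 * c) *\<^sub>R ((\<mu> k *\<^sub>R p k) * P)"
      by (simp add: scaleR_mult_rpoly flip: scaleR_add_left)
    finally show ?thesis by (simp add: power2_eq_square mult_ac)
  qed
  then have "(\<Sum>k\<in>A. (p k + (c * \<mu> k) *\<^sub>R P)\<^sup>2) =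
      (\<Sum>k\<in>A. (p k)\<^sup>2) + (2 * c) *\<^sub>R ((\<Sum>k\<in>A. \<mu> k *\<^sub>R p k) * P) + (c\<^sup>2 * M) *\<^sub>R P\<^sup>2"
    by (simp add: sum.distrib scaleR_sum_right sum_distrib_right sum_distrib_left scaleR_sum_left M_def)
  also have "\<dots> = (\<Sum>k\<in>A. (p k)\<^sup>2) + (2 * c + c\<^sup>2 * M) *\<^sub>R P\<^sup>2"
    unfolding assms(2)[symmetric] by (simp add: power2_eq_square scaleR_add_left)
  finally show "(\<Sum>k\<in>A. (p k + (c * \<mu> k) *\<^sub>R P)\<^sup>2) = (\<Sum>k\<in>A. (p k)\<^sup>2) + P\<^sup>2"
    by (simp add: cM)
qed

text \<open>As long as there are more squares than elements of \<open>B\<close>, some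
  \<open>p i\<close> is a combination of the others, and \<open>absorb_square\<close> distributes
  its square over them without leaving \<open>V\<close>.\<close>

lemma shorten_sum_of_squares:
  fixes p :: "nat \<Rightarrow> 'v rpoly"
  assumes "finite A" "\<And>k. k \<in> A \<Longrightarrow> p k \<in> V" "subspace V" "V \<subseteq> span B" "finite B"
  shows "\<exists>r q. r \<le> card B \<and> (\<forall>k<r. q k \<in> V) \<and> (\<Sum>k\<in>A. (p k)\<^sup>2) = (\<Sum>k<r. (q k)\<^sup>2)"
  using assms(1,2)
proof (induction "card A" arbitrary: A p rule: less_induct)
  case less
  show ?case
  proof (cases "card A \<le> card B")
    case True
    obtain h where h: "bij_betw h {..<card A} A"
      using ex_bij_betw_nat_finite[OF less.prems(1)] by (auto simp: atLeast0LessThan)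
    have "(\<Sum>k<card A. (p (h k))\<^sup>2) = (\<Sum>k\<in>A. (p k)\<^sup>2)" by (rule sum.reindex_bij_betw[OF h])
    moreover have "p (h k) \<in> V" if "k < card A" for k
      using h that less.prems(2) by (auto simp: bij_betw_def)
    ultimately show ?thesis using True by (intro exI[of _ "card A"] exI[of _ "p \<circ> h"]) auto
  next
    case False
    then have lt: "card B < card A" by simp
    have sp: "p k \<in> span B" if "k \<in> A" for k using less.prems(2)[OF that] assms(4) by blast
    obtain u i where ui: "i \<in> A" "u i \<noteq> 0" "(\<Sum>k\<in>A. u k *\<^sub>R p k) = 0"
      by (rule linear_relation[where p = p, OF less.prems(1) sp assms(5) lt]) blast+
    let ?A = "A - {i}"
    have "u i *\<^sub>R p i = - (\<Sum>k\<in>?A. u k *\<^sub>R p k)"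
      using ui less.prems(1) by (simp add: sum.remove eq_neg_iff_add_eq_0)
    moreover have "p i = inverse (u i) *\<^sub>R (u i *\<^sub>R p i)" using ui(2) by simp
    ultimately have "p i = inverse (u i) *\<^sub>R (- (\<Sum>k\<in>?A. u k *\<^sub>R p k))" by simp
    also have "\<dots> = (\<Sum>k\<in>?A. (- u k / u i) *\<^sub>R p k)"
      by (simp add: scaleR_sum_right sum_negf divide_inverse mult.commute)
    finally obtain c where c: "(\<Sum>k\<in>?A. (p k + (c * (- u k / u i)) *\<^sub>R p i)\<^sup>2) = (\<Sum>k\<in>?A. (p k)\<^sup>2) + (p i)\<^sup>2"
      using absorb_square[of ?A "p i" "\<lambda>k. - u k / u i" p] less.prems(1) by auto
    let ?q = "\<lambda>k. p k + (c * (- u k / u i)) *\<^sub>R p i"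
    have "card ?A < card A" using less.prems(1) ui(1) by (rule card_Diff1_less)
    moreover have "?q k \<in> V" if "k \<in> ?A" for k
      using that less.prems(2) ui(1) by (intro subspace_add subspace_scale assms(3)) auto
    ultimately have "\<exists>r q. r \<le> card B \<and> (\<forall>k<r. q k \<in> V) \<and> (\<Sum>k\<in>?A. (?q k)\<^sup>2) = (\<Sum>k<r. (q k)\<^sup>2)"
      using less.prems(1) by (intro less.hyps) auto
    moreover have "(\<Sum>k\<in>?A. (?q k)\<^sup>2) = (\<Sum>k\<in>A. (p k)\<^sup>2)"
      unfolding c sum.remove[OF less.prems(1) ui(1)] by (rule add.commute)
    ultimately show ?thesis by simp
  qed
qed

subsection \<open>Gram matrices\<close>

lemma linear_functional_poly:
  fixes g :: "'n::finite rpoly \<Rightarrow> real"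
  assumes "linear g"
  obtains L :: "'n monomial rpoly" where
    "\<And>f. f \<in> forms e \<Longrightarrow> peval L (Poly_Mapping.lookup f) = g f"
proof
  let ?M = "{m :: 'n monomial. mdegree m = e}"
  \<comment> \<open>\<open>Poly_Mapping.single m 1\<close> occurs in two roles: as the variable
    indexed by \<open>m\<close>, and as the form \<open>m\<close> to which \<open>g\<close> is
    applied.\<close>
  let ?L = "\<Sum>m\<in>?M. Poly_Mapping.single (Poly_Mapping.single m 1) (g (Poly_Mapping.single m 1))"
  fix f :: "'n rpoly" assume f: "f \<in> forms e"
  have "f = (\<Sum>m\<in>Poly_Mapping.keys f. Poly_Mapping.lookup f m *\<^sub>R Poly_Mapping.single m 1)"
    using poly_mapping_sum_single[of f] by (simp add: scaleR_rpoly mult_single)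
  also have "\<dots> = (\<Sum>m\<in>?M. Poly_Mapping.lookup f m *\<^sub>R Poly_Mapping.single m 1)"
    using f card_monomials(1) by (intro sum.mono_neutral_left) (auto simp: forms_def in_keys_iff)
  finally have "g f = g (\<Sum>m\<in>?M. Poly_Mapping.lookup f m *\<^sub>R Poly_Mapping.single m 1)" by simp
  also have "\<dots> = (\<Sum>m\<in>?M. Poly_Mapping.lookup f m * g (Poly_Mapping.single m 1))"
    by (simp add: linear_sum[OF assms] linear_cmul[OF assms])
  also have "\<dots> = peval ?L (Poly_Mapping.lookup f)"
    by (simp add: peval_sum mono_eval_def mult.commute)
  finally show "peval ?L (Poly_Mapping.lookup f) = g f" by simp
qed

text \<open>The functional reading off the entry $(i,j)$ of twice the Gram matrix.\<close>

lemma gram_functional: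
  fixes b :: "nat \<Rightarrow> 'v rpoly"
  assumes indep: "\<And>u x. (\<Sum>x\<in>index_pairs t. u x *\<^sub>R (case x of (j, i) \<Rightarrow> b j * b i)) = 0 \<Longrightarrow>
      x \<in> index_pairs t \<Longrightarrow> u x = 0"
  obtains g :: "'v rpoly \<Rightarrow> real" where "linear g"
    "\<And>k l. k < t \<Longrightarrow> l < t \<Longrightarrow> g (b k * b l) = (if i = k \<and> j = l then 1 else 0) + (if i = l \<and> j = k then 1 else 0)"
proof -
  let ?b = "\<lambda>x. case x of (j, i) \<Rightarrow> b j * b i"
  \<comment> \<open>An off-diagonal product receives two equal entries of the Gram matrix and a
    diagonal one a single entry. The values 1 and 2 therefore read off twice the entry in both
    cases.\<close>
  let ?d = "\<lambda>(k, l). (if i = k \<and> j = l then 1 else 0) + (if i = l \<and> j = k then 1 else (0 :: real))"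
  note image = independent_imageI[where b = ?b and I = "index_pairs t"]
  have ind: "independent (?b ` index_pairs t)"
    by (rule image(1)) (simp, fact indep)
  have inj: "inj_on ?b (index_pairs t)"
    by (rule image(2)) (simp, fact indep)
  obtain g where g: "linear g" "\<forall>x\<in>?b ` index_pairs t. g x = ?d (inv_into (index_pairs t) ?b x)"
    using linear_independent_extend[OF ind, of "\<lambda>x. ?d (inv_into (index_pairs t) ?b x)"] by blast
  have tri: "g (b k * b l) = ?d (k, l)" if "(k, l) \<in> index_pairs t" for k l
  proof -
    have "g (?b (k, l)) = ?d (inv_into (index_pairs t) ?b (?b (k, l)))" using g(2) that by blast
    also have "inv_into (index_pairs t) ?b (?b (k, l)) = (k, l)" by (rule inv_into_f_f[OF inj that])
    finally show ?thesis by simp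
  qed
  show thesis
  proof (rule that[OF g(1)])
    fix k l assume kl: "k < t" "l < t"
    show "g (b k * b l) = (if i = k \<and> j = l then 1 else 0) + (if i = l \<and> j = k then 1 else 0)"
    proof (cases "l \<le> k")
      case True
      then show ?thesis using tri[of k l] kl by (simp add: index_pairs_def)
    next
      case False
      then have "g (b l * b k) = ?d (l, k)" using kl by (intro tri) (simp add: index_pairs_def)
      then show ?thesis by (simp add: mult.commute add.commute)
    qed
  qed
qed

text \<open>A single square has a Gram matrix of rank at most one, the outer product of its
  coefficient vector with itself.\<close>

lemma gram_of_square:
  fixes b :: "nat \<Rightarrow> 'v rpoly" and g :: "'v rpoly \<Rightarrow> real"
  assumes g: "linear g" "\<And>k l. k < t \<Longrightarrow> l < t \<Longrightarrow>
      g (b k * b l) = (if i = k \<and> j = l then 1 else 0) + (if i = l \<and> j = k then 1 else 0)"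
    and ij: "i < t" "j < t"
  shows "g ((\<Sum>k<t. a k *\<^sub>R b k)\<^sup>2) = 2 * (a i * a j)"
proof -
  have "(\<Sum>k<t. a k *\<^sub>R b k)\<^sup>2 = (\<Sum>k<t. \<Sum>l<t. (a k * a l) *\<^sub>R (b k * b l))"
    by (simp add: power2_eq_square sum_product scaleR_mult_rpoly mult.commute)
  then have "g ((\<Sum>k<t. a k *\<^sub>R b k)\<^sup>2) = (\<Sum>k<t. \<Sum>l<t. (a k * a l) *
      ((if i = k \<and> j = l then 1 else 0) + (if i = l \<and> j = k then 1 else 0)))"
    by (simp add: linear_sum[OF g(1)] linear_cmul[OF g(1)] g(2))
  also have "\<dots> = (\<Sum>k<t. (if k = i then a i * a j else 0) + (if k = j then a i * a j else 0))"
  proof (rule sum.cong[OF refl])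
    fix k
    have "(\<Sum>l<t. (a k * a l) * ((if i = k \<and> j = l then 1 else 0) + (if i = l \<and> j = k then 1 else 0)))
      = (\<Sum>l<t. (if l = j then if k = i then a i * a j else 0 else 0) + (if l = i then if k = j then a i * a j else 0 else 0))"
      by (rule sum.cong) (auto simp: mult.commute)
    also have "\<dots> = (if k = i then a i * a j else 0) + (if k = j then a i * a j else 0)"
      using ij by (simp add: sum.distrib)
    finally show "(\<Sum>l<t. (a k * a l) * ((if i = k \<and> j = l then 1 else 0) + (if i = l \<and> j = k then 1 else 0)))
      = (if k = i then a i * a j else 0) + (if k = j then a i * a j else 0)" .
  qed
  also have "\<dots> = 2 * (a i * a j)" using ij by (simp add: sum.distrib)
  finally show ?thesis .
qed

text \<open>A sum of \<open>r\<close> matrices of rank at most one is singular when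
  \<open>r < t\<close>: padded with zero columns, its left factor \<open>?A\<close> annihilates the
  unit vector with index \<open>r\<close>.\<close>

lemma det_gram_zero:
  fixes a :: "nat \<Rightarrow> nat \<Rightarrow> real"
  assumes "r < t"
  shows "det (mat t t (\<lambda>(i, j). 2 * (\<Sum>k<r. a k i * a k j))) = 0"
proof -
  let ?a = "\<lambda>i k. if k < r then a k i else 0"
  let ?A = "mat t t (\<lambda>(i, k). ?a i k)" and ?B = "mat t t (\<lambda>(k, j). 2 * ?a j k)"
  have "mat t t (\<lambda>(i, j). 2 * (\<Sum>k<r. a k i * a k j)) = ?A * ?B"
  proof (rule eq_matI)
    fix i j assume "i < dim_row (?A * ?B)" "j < dim_col (?A * ?B)"
    then have ij: "i < t" "j < t" by auto
    have "2 * (\<Sum>k<r. a k i * a k j) = (\<Sum>k<r. ?a i k * (2 * ?a j k))"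
      unfolding sum_distrib_left by (rule sum.cong) auto
    also have "\<dots> = (\<Sum>k<t. ?a i k * (2 * ?a j k))"
      using assms by (intro sum.mono_neutral_left) auto
    finally show "mat t t (\<lambda>(i, j). 2 * (\<Sum>k<r. a k i * a k j)) $$ (i, j) = (?A * ?B) $$ (i, j)"
      using ij by (simp add: scalar_prod_def atLeast0LessThan)
  qed auto
  moreover have "det ?A = 0"
  proof (rule ccontr)
    assume "det ?A \<noteq> 0"
    then have "(if r = r then 1 else 0) = (0 :: real)"
    proof (rule det_nonzero_kernel[where u = "\<lambda>k. if k = r then 1 else 0"])
      show "(\<Sum>k<t. ?a i k * (if k = r then 1 else 0)) = 0" for i
        by (rule sum.neutral) auto
    qed (rule assms)
    then show False by simp
  qed
  ultimately show ?thesis by (simp add: det_mult[of _ t])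
qed

lemma sos_squares_through:
  fixes Z :: "(real ^ 'n::finite) set set" and p :: "nat \<Rightarrow> 'n rpoly"
  assumes "\<And>k. k < r \<Longrightarrow> p k \<in> forms d" "vanishes_on (\<Sum>k<r. (p k)\<^sup>2) Z" "k < r"
  shows "p k \<in> forms_through d Z"
proof -
  have "peval (p k) (vec_nth v) = 0" if "L \<in> Z" "v \<in> L" for L v
  proof -
    have "(\<Sum>k<r. (peval (p k) (vec_nth v))\<^sup>2) = 0"
      using assms(2) that by (simp add: vanishes_on_def peval_sum peval_power)
    then have "\<forall>k\<in>{..<r}. (peval (p k) (vec_nth v))\<^sup>2 = 0"
      by (simp add: sum_nonneg_eq_0_iff)
    then show ?thesis using assms(3) by simp
  qed
  then show ?thesis using assms(1,3) by (simp add: forms_through_def vanishes_on_def)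
qed

text \<open>The second claim is proved separately because a proper algebraic subset of the span is
  not obviously too small to contain the whole cone; an explicit element settles both
  claims.\<close>

lemma generic_sos_length:
  fixes Z :: "(real ^ 'n::finite) set set" and b :: "nat \<Rightarrow> 'n rpoly"
  assumes b: "\<And>i. i < t \<Longrightarrow> b i \<in> forms_through d Z" "forms_through d Z \<subseteq> span (b ` {..<t})"
    and indep: "\<And>u x. (\<Sum>x\<in>index_pairs t. u x *\<^sub>R (case x of (j, i) \<Rightarrow> b j * b i)) = 0 \<Longrightarrow>
      x \<in> index_pairs t \<Longrightarrow> u x = 0"
  shows "for_generic_vanishing_sos d Z (\<lambda>f. sos_length d f = t)"
    and "\<exists>f\<in>sos_cone d :: 'n rpoly set. sos_length d f = t"
proof -
  let ?V = "forms_through d Z"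
  have ex_g: "\<exists>g :: 'n rpoly \<Rightarrow> real. linear g \<and> (\<forall>k<t. \<forall>l<t. g (b k * b l) =
      (if i = k \<and> j = l then 1 else 0) + (if i = l \<and> j = k then 1 else 0))" for i j
    by (rule gram_functional[where t = t and b = b and i = i and j = j]) (use indep in blast)+
  have "\<exists>g :: nat \<Rightarrow> nat \<Rightarrow> 'n rpoly \<Rightarrow> real. \<forall>i j. linear (g i j) \<and> (\<forall>k<t. \<forall>l<t. g i j (b k * b l) =
      (if i = k \<and> j = l then 1 else 0) + (if i = l \<and> j = k then 1 else 0))"
    by (intro choice allI ex_g)
  then obtain g :: "nat \<Rightarrow> nat \<Rightarrow> 'n rpoly \<Rightarrow> real" where lin: "\<And>i j. linear (g i j)"
    and g: "\<And>i j k l. k < t \<Longrightarrow> l < t \<Longrightarrow> g i j (b k * b l) =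
      (if i = k \<and> j = l then 1 else 0) + (if i = l \<and> j = k then 1 else 0)"
    by blast
  have ex_L: "\<exists>L :: 'n monomial rpoly. \<forall>f\<in>forms (2 * d). peval L (Poly_Mapping.lookup f) = g i j f" for i j
    by (rule linear_functional_poly[OF lin]) blast
  have "\<exists>L :: nat \<Rightarrow> nat \<Rightarrow> 'n monomial rpoly. \<forall>i j. \<forall>f\<in>forms (2 * d).
      peval (L i j) (Poly_Mapping.lookup f) = g i j f"
    by (intro choice allI ex_L)
  then obtain L :: "nat \<Rightarrow> nat \<Rightarrow> 'n monomial rpoly" where
    L: "\<And>i j f. f \<in> forms (2 * d) \<Longrightarrow> peval (L i j) (Poly_Mapping.lookup f) = g i j f"
    by blast
  \<comment> \<open>The determinant of the doubled Gram matrix as a polynomial in the coefficients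
    of a form; its zeros are the exceptional set.\<close>
  define P where "P = det (mat t t (\<lambda>(i, j). L i j))"
  have P: "peval P (Poly_Mapping.lookup f) = det (mat t t (\<lambda>(i, j). g i j f))" if "f \<in> forms (2 * d)" for f
  proof -
    have "map_mat (\<lambda>p. peval p (Poly_Mapping.lookup f)) (mat t t (\<lambda>(i, j). L i j)) = mat t t (\<lambda>(i, j). g i j f)"
      by (rule eq_matI) (auto simp: L[OF that])
    then show ?thesis by (simp add: P_def peval_det)
  qed
  have rank: "t \<le> r" if f: "f = (\<Sum>k<r. (p k)\<^sup>2)" "\<And>k. k < r \<Longrightarrow> p k \<in> ?V"
    and nz: "det (mat t t (\<lambda>(i, j). g i j f)) \<noteq> 0" for f p r
  proof (rule ccontr)
    assume "\<not> t \<le> r"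
    have "\<exists>a. \<forall>k. k < r \<longrightarrow> p k = (\<Sum>i<t. a k i *\<^sub>R b i)"
    proof (intro choice allI)
      fix k show "\<exists>a. k < r \<longrightarrow> p k = (\<Sum>i<t. a i *\<^sub>R b i)"
      proof (cases "k < r")
        case True
        then have "p k \<in> span (b ` {..<t})" using f(2) b(2) by blast
        then show ?thesis by (rule span_family[OF finite_lessThan]) blast
      qed simp
    qed
    then obtain a where a: "\<And>k. k < r \<Longrightarrow> p k = (\<Sum>i<t. a k i *\<^sub>R b i)" by blast
    have "g i j f = 2 * (\<Sum>k<r. a k i * a k j)" if "i < t" "j < t" for i j
      unfolding f(1) linear_sum[OF lin] sum_distrib_left
      by (rule sum.cong) (use that a gram_of_square[OF lin g] in auto)
    then have "mat t t (\<lambda>(i, j). g i j f) = mat t t (\<lambda>(i, j). 2 * (\<Sum>k<r. a k i * a k j))"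
      by (intro eq_matI) auto
    then show False using nz det_gram_zero[of r t a] \<open>\<not> t \<le> r\<close> by simp
  qed
  have len: "sos_length d f = t"
    if f: "f \<in> vanishing_sos d Z" and nz: "det (mat t t (\<lambda>(i, j). g i j f)) \<noteq> 0" for f
    unfolding sos_length_def
  proof (rule Least_equality)
    have lower: "t \<le> r" "\<And>k. k < r \<Longrightarrow> p k \<in> ?V"
      if p: "\<And>k. k < r \<Longrightarrow> p k \<in> forms d" "f = (\<Sum>k<r. (p k)\<^sup>2)" for r p
    proof -
      show V: "p k \<in> ?V" if "k < r" for k
        using sos_squares_through[where p = p and Z = Z, OF p(1)] f that by (auto simp: p(2) vanishing_sos_def)
      show "t \<le> r" by (rule rank[OF p(2) V nz])
    qed
    show "t \<le> r" if "sum_of_squares d r f" for r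
      using that lower(1) unfolding sum_of_squares_def by blast
    obtain r where "sum_of_squares d r f"
      using f unfolding vanishing_sos_def sos_cone_def by blast
    then obtain p where "\<forall>k<r. p k \<in> forms d" and p2: "f = (\<Sum>k<r. (p k)\<^sup>2)"
      unfolding sum_of_squares_def by blast
    then have p1: "p k \<in> forms d" if "k < r" for k using that by blast
    note p = p1 p2
    have "\<exists>r' q. r' \<le> card (b ` {..<t}) \<and> (\<forall>k<r'. q k \<in> ?V) \<and> (\<Sum>k<r. (p k)\<^sup>2) = (\<Sum>k<r'. (q k)\<^sup>2)"
      using lower(2)[OF p] b(2) by (intro shorten_sum_of_squares subspace_forms_through) auto
    then obtain r' q where q: "r' \<le> card (b ` {..<t})" "\<And>k. k < r' \<Longrightarrow> q k \<in> ?V"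
      "f = (\<Sum>k<r'. (q k)\<^sup>2)" using p(2) by auto
    have "r' \<le> t" using q(1) card_image_le[of "{..<t}" b] by simp
    moreover have "t \<le> r'" by (rule rank[OF q(3,2) nz])
    ultimately show "sum_of_squares d t f"
      using q(2,3) unfolding sum_of_squares_def forms_through_def by (intro exI[of _ q]) auto
  qed
  \<comment> \<open>Its doubled Gram matrix is twice the identity, so the exceptional set is proper
    and the length \<open>t\<close> is attained.\<close>
  define f0 where "f0 = (\<Sum>k<t. (b k)\<^sup>2)"
  have f0_forms: "f0 \<in> forms (2 * d)"
    unfolding f0_def mult_2 power2_eq_square using b(1)
    by (intro subspace_sum subspace_forms forms_mult) (auto simp: forms_through_def)
  have "sum_of_squares d t f0"
    using b(1) unfolding sum_of_squares_def f0_def forms_through_def by (intro exI[of _ b]) auto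
  moreover have "vanishes_on f0 Z"
    unfolding vanishes_on_def f0_def
    using b(1) by (auto simp: peval_sum peval_power forms_through_def vanishes_on_def)
  ultimately have f0: "f0 \<in> vanishing_sos d Z" "f0 \<in> sos_cone d"
    using f0_forms by (auto simp: vanishing_sos_def sos_cone_def)
  have f0_nz: "det (mat t t (\<lambda>(i, j). g i j f0)) \<noteq> 0"
  proof -
    have "g i j f0 = (if i = j then 2 else 0)" if "i < t" "j < t" for i j
    proof -
      have "g i j f0 = (\<Sum>k<t. if k = i then (if i = j then 2 else 0) else 0)"
        unfolding f0_def linear_sum[OF lin] power2_eq_square by (rule sum.cong) (auto simp: g)
      then show ?thesis using that by simp
    qed
    then have "mat t t (\<lambda>(i, j). g i j f0) = 2 \<cdot>\<^sub>m 1\<^sub>m t" by (intro eq_matI) auto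
    then show ?thesis by simp
  qed
  show "for_generic_vanishing_sos d Z (\<lambda>f. sos_length d f = t)"
    unfolding for_generic_vanishing_sos_def
  proof (intro exI conjI ballI)
    let ?S = "span (vanishing_sos d Z)" and ?W = "{f \<in> span (vanishing_sos d Z). \<forall>Q\<in>{P}. peval Q (Poly_Mapping.lookup f) = 0}"
    show "algebraic_subset ?S ?W" unfolding algebraic_subset_def by blast
    have "f0 \<in> ?S" "f0 \<notin> ?W" using f0(1) f0_nz by (auto simp: P[OF f0_forms] span_base)
    then show "?W \<noteq> ?S" by blast
    fix f assume f: "f \<in> vanishing_sos d Z - ?W"
    then have "f \<in> forms (2 * d)" by (simp add: vanishing_sos_def sos_cone_def)
    then show "sos_length d f = t" using f by (intro len) (auto simp: P span_base)
  qed
  show "\<exists>f\<in>sos_cone d :: 'n rpoly set. sos_length d f = t"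
    using f0(2) len[OF f0(1) f0_nz] by blast
qed

subsection \<open>The critical number of points\<close>

lemma num_forms_Suc_vars:
  assumes "c \<ge> 1"
  shows "real c * real (num_forms (Suc c) k) = real (c + k) * real (num_forms c k)"
proof -
  obtain b where c: "c = Suc b" using assms by (cases c) auto
  have "Suc b * (Suc (b + k) choose Suc b) = Suc (b + k) * (b + k choose b)"
    by (rule Suc_times_binomial)
  then have "c * num_forms (Suc c) k = (c + k) * num_forms c k"
    by (simp add: c num_forms_def)
  then show ?thesis by (metis of_nat_mult)
qed

lemma num_forms_rec:
  assumes "c \<ge> 1"
  shows "num_forms (Suc c) (Suc k) = num_forms (Suc c) k + num_forms c (Suc k)"
proof -
  obtain b where c: "c = Suc b" using assms by (cases c) auto
  show ?thesis by (simp add: c num_forms_def)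
qed

lemma num_forms_Suc_degree:
  assumes "c \<ge> 1"
  shows "real (Suc k) * real (num_forms c (Suc k)) = real (c + k) * real (num_forms c k)"
proof -
  obtain b where c: "c = Suc b" using assms by (cases c) auto
  have "Suc k * (b + Suc k choose Suc k) = (b + Suc k) * (b + k choose k)"
    using Suc_times_binomial[of k "b + k"] by simp
  then have "Suc k * num_forms c (Suc k) = (c + k) * num_forms c k"
    using binomial_symmetric[of b "b + k"] binomial_symmetric[of b "b + Suc k"]
    by (simp add: c num_forms_def)
  then show ?thesis by (metis of_nat_mult)
qed

lemma num_forms_pos: "c \<ge> 1 \<Longrightarrow> num_forms c k > 0"
  by (simp add: num_forms_def)

lemma num_forms_mono:
  assumes "c \<ge> 1"
  shows "num_forms c k \<le> num_forms c (k + j)"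
  using assms unfolding num_forms_def by (intro binomial_right_mono) auto

text \<open>There is equality for \<open>c = 2\<close>.  Passing from \<open>c\<close> to \<open>c + 1\<close> multiplies the left-hand side by
  less than $1+2d/c$, and the right-hand side by at least that much since $c(2d-1)\le dN_{c,d}$.\<close>

lemma sum_num_forms_less:
  assumes "d \<ge> 2" "c \<ge> 2"
  shows "(\<Sum>j=1..d. real (num_forms c (d + j)))
      \<le> real (num_forms c d) * (real (num_forms c d) - 1 + 2 * real d) / 2 \<and>
    (c \<ge> 3 \<longrightarrow> (\<Sum>j=1..d. real (num_forms c (d + j)))
      < real (num_forms c d) * (real (num_forms c d) - 1 + 2 * real d) / 2)"
  using assms(2)
proof (induction c rule: dec_induct)
  case base
  have N: "real (num_forms 2 k) = real k + 1" for k by (simp add: num_forms_def)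
  have "(\<Sum>j=1..m. real (d + j) + 1) = real m * (real d + 1) + real m * (real m + 1) / 2" for m
    by (induction m) (simp_all add: field_simps)
  from this[of d] show ?case by (simp add: N field_simps)
next
  case (step c)
  let ?A = "\<lambda>c. \<Sum>j=1..d. real (num_forms c (d + j))"
  define M where "M = real (num_forms c d)"
  define C where "C = real c"
  define D where "D = real d"
  have C: "C \<ge> 2" and D: "D \<ge> 2" using step assms by (simp_all add: C_def D_def)
  have M: "C * real (num_forms (Suc c) d) = (C + D) * M"
    using num_forms_Suc_vars[of c d] step by (simp add: M_def C_def D_def)
  have "C * ?A (Suc c) = (\<Sum>j=1..d. (C + D + real j) * real (num_forms c (d + j)))"
    using num_forms_Suc_vars[of c] step unfolding sum_distrib_left
    by (intro sum.cong) (simp_all add: C_def D_def add_ac)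
  also have "\<dots> < (\<Sum>j=1..d. (C + 2 * D) * real (num_forms c (d + j)))"
  proof (rule sum_strict_mono_ex1)
    show "\<exists>j\<in>{1..d}. (C + D + real j) * real (num_forms c (d + j)) < (C + 2 * D) * real (num_forms c (d + j))"
      using assms step by (intro bexI[of _ 1]) (auto simp: D_def intro!: mult_strict_right_mono num_forms_pos)
  qed (auto simp: D_def intro!: mult_right_mono)
  also have "\<dots> = (C + 2 * D) * ?A c" by (simp add: sum_distrib_left)
  also have "\<dots> \<le> (C + 2 * D) * (M * (M - 1 + 2 * D) / 2)"
    using step.IH C D by (intro mult_left_mono) (auto simp: M_def D_def)
  finally have A: "C * ?A (Suc c) < (C + 2 * D) * (M * (M - 1 + 2 * D) / 2)" .
  have key: "C * (2 * D - 1) \<le> D * M"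
  proof (cases "c = 2")
    case True
    then have "M = D + 1" "C = 2" by (simp_all add: M_def D_def C_def num_forms_def)
    moreover have "0 \<le> (D - 1) * (D - 2)" using D by simp
    ultimately show ?thesis by (simp add: algebra_simps)
  next
    case False
    then have c3: "C \<ge> 3" using step by (simp add: C_def)
    have "num_forms c 2 \<le> num_forms c d"
      using num_forms_mono[of c 2 "d - 2"] assms step.hyps by (simp del: add_2_eq_Suc)
    moreover have "2 * real (num_forms c 2) = C * (C + 1)"
      using num_forms_Suc_degree[of c 0] num_forms_Suc_degree[of c 1] step
      by (simp add: C_def num_forms_def numeral_2_eq_2 mult.commute)
    ultimately have "C * (C + 1) \<le> 2 * M" by (simp add: M_def)
    moreover have "C * 4 \<le> C * (C + 1)" using c3 by (intro mult_left_mono) auto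
    ultimately have "2 * C \<le> M" by simp
    then have "D * (2 * C) \<le> D * M" using D by (intro mult_left_mono) auto
    moreover have "C * (2 * D - 1) \<le> D * (2 * C)" using C by (simp add: algebra_simps)
    ultimately show ?thesis by linarith
  qed
  \<comment> \<open>Induction step after multiplying by 2C^2, using C N_{c+1,d} = (C + D) M from the
    fact \<open>M\<close>, and removing the common factor M.\<close>
  have "C * ((C + 2 * D) * (M - 1 + 2 * D)) \<le> (C + D) * ((C + D) * M + C * (2 * D - 1))"
  proof -
    have "(C + D) * ((C + D) * M + C * (2 * D - 1)) - C * ((C + 2 * D) * (M - 1 + 2 * D))
        = D * (D * M - C * (2 * D - 1))" by (simp add: algebra_simps)
    moreover have "D * (D * M - C * (2 * D - 1)) \<ge> 0" using key D by simp
    ultimately show ?thesis by linarith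
  qed
  then have "M * (C * ((C + 2 * D) * (M - 1 + 2 * D))) \<le> M * ((C + D) * ((C + D) * M + C * (2 * D - 1)))"
    by (rule mult_left_mono) (simp add: M_def)
  then have *: "M * (C * ((C + 2 * D) * (M - 1 + 2 * D))) / 2 \<le> M * ((C + D) * ((C + D) * M + C * (2 * D - 1))) / 2"
    by (rule divide_right_mono) simp
  have "C * ((C + 2 * D) * (M * (M - 1 + 2 * D) / 2)) = M * (C * ((C + 2 * D) * (M - 1 + 2 * D))) / 2"
    by simp
  also note *
  also have "M * ((C + D) * ((C + D) * M + C * (2 * D - 1))) / 2 = (C + D) * M * ((C + D) * M + C * (2 * D - 1)) / 2"
    by simp
  also have "\<dots> = C * (C * (real (num_forms (Suc c) d) * (real (num_forms (Suc c) d) - 1 + 2 * D) / 2))"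
    unfolding M[symmetric] by (simp add: algebra_simps)
  finally have "(C + 2 * D) * (M * (M - 1 + 2 * D) / 2)
      \<le> C * (real (num_forms (Suc c) d) * (real (num_forms (Suc c) d) - 1 + 2 * D) / 2)"
    using C by (simp only: mult_le_cancel_left_pos)
  with A have "C * ?A (Suc c) < C * (real (num_forms (Suc c) d) * (real (num_forms (Suc c) d) - 1 + 2 * D) / 2)"
    by (rule less_le_trans)
  then have "?A (Suc c) < real (num_forms (Suc c) d) * (real (num_forms (Suc c) d) - 1 + 2 * D) / 2"
    using C by (simp only: mult_less_cancel_left_pos)
  then show ?case by (simp add: D_def)
qed

text \<open>Pascal's rule telescoped over the degree; with \<open>m = d\<close> it turns N_{n,2d} -
  N_{n,d} into the sum bounded above, in one variable less.\<close>

lemma num_forms_sum: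
  assumes "c \<ge> 1"
  shows "num_forms (Suc c) (d + m) = num_forms (Suc c) d + (\<Sum>j=1..m. num_forms c (d + j))"
proof (induction m)
  case (Suc m)
  then show ?case using num_forms_rec[OF assms, of "d + m"] by simp
qed simp

text \<open>Expresses that s = N_d - n satisfies the inequality defining \<open>s_min\<close>,
  because n^2 - n(n+1)/2 = n(n-1)/2. The stronger n N_d \<le> N_{2d} passes from d to d + 1; it
  starts at d = 2 for n \<ge> 6 and at d = 3 for n = 4 and n = 5, where d = 2 needs the extra
  term.\<close>

lemma num_forms_upper:
  assumes "n \<ge> 4" "d \<ge> 2"
  shows "real n * real (num_forms n d) \<le> real (num_forms n (2 * d)) + real n * (real n - 1) / 2"
proof -
  define N where "N = (\<lambda>e. real (num_forms n e))"
  have n: "n \<ge> 1" using assms by simp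
  have S: "(real k + 1) * N (Suc k) = (real n + real k) * N k" for k
    using num_forms_Suc_degree[OF n, of k] by (simp add: N_def algebra_simps)
  have pos: "N k > 0" for k using num_forms_pos[OF n] by (simp add: N_def)
  have N0: "N 0 = 1" by (simp add: N_def num_forms_def)
  have N1: "N 1 = real n" using S[of 0] N0 by simp
  have N2: "2 * N 2 = (real n + 1) * real n" using S[of 1] N1 by (simp add: numeral_2_eq_2)
  have N3: "3 * N 3 = (real n + 2) * N 2" using S[of 2] by (simp add: numeral_3_eq_3 numeral_2_eq_2)
  have N4: "4 * N 4 = (real n + 3) * N 3" using S[of 3] by (simp add: eval_nat_numeral)
  \<comment> \<open>The growth factors are (n+d)/(d+1) for N_d and (n+2d)(n+2d+1)/((2d+1)(2d+2)) for
    N_{2d}; after clearing denominators they differ by n^2 - n.\<close>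
  have step: "real n * N (Suc d) \<le> N (2 * Suc d)" if "real n * N d \<le> N (2 * d)" for d
  proof -
    let ?d = "real d" and ?n = "real n"
    have "(2 * ?d + 2) * (2 * ?d + 1) * (?n * N (Suc d)) = 2 * (2 * ?d + 1) * ?n * ((?d + 1) * N (Suc d))"
      by (simp add: algebra_simps)
    also have "\<dots> = 2 * (2 * ?d + 1) * ?n * ((?n + ?d) * N d)" by (simp only: S)
    also have "\<dots> = (2 * ?d + 1) * (2 * (?n + ?d)) * (?n * N d)" by (simp only: mult_ac)
    also have "\<dots> \<le> (2 * ?d + 1) * (2 * (?n + ?d)) * N (2 * d)"
      using that by (intro mult_left_mono) auto
    also have "\<dots> \<le> (?n + 2 * ?d + 1) * (?n + 2 * ?d) * N (2 * d)"
    proof (rule mult_right_mono)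
      have "?n * 1 \<le> ?n * ?n" using assms by (intro mult_left_mono) auto
      then show "(2 * ?d + 1) * (2 * (?n + ?d)) \<le> (?n + 2 * ?d + 1) * (?n + 2 * ?d)"
        by (simp add: algebra_simps)
    qed (simp add: pos less_imp_le)
    also have "\<dots> = (?n + 2 * ?d + 1) * ((2 * ?d + 1) * N (2 * d + 1))"
      using S[of "2 * d"] by simp
    also have "\<dots> = (2 * ?d + 1) * ((?n + 2 * ?d + 1) * N (2 * d + 1))" by (simp only: mult_ac)
    also have "\<dots> = (2 * ?d + 1) * ((2 * ?d + 2) * N (2 * d + 2))"
      using S[of "2 * d + 1"] by (simp add: add_ac)
    also have "\<dots> = (2 * ?d + 2) * (2 * ?d + 1) * N (2 * Suc d)" by simp
    finally have "(2 * ?d + 2) * (2 * ?d + 1) * (?n * N (Suc d)) \<le> (2 * ?d + 2) * (2 * ?d + 1) * N (2 * Suc d)" .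
    then show ?thesis by (subst (asm) mult_le_cancel_left_pos) auto
  qed
  have ge: "real n * N e \<le> N (2 * e)" if "real n * N d0 \<le> N (2 * d0)" "d0 \<le> e" for d0 e
    using that(2,1) by (induction e rule: dec_induct) (assumption, rule step)
  have N5: "5 * N 5 = (real n + 4) * N 4" using S[of 4] by (simp add: eval_nat_numeral)
  have N6: "6 * N 6 = (real n + 5) * N 5" using S[of 5] by (simp add: eval_nat_numeral)
  consider "n \<ge> 6" | "n \<in> {4, 5}" using assms by fastforce
  then have "real n * N d \<le> N (2 * d) + real n * (real n - 1) / 2"
  proof cases
    case 1
    have "0 \<le> (real n - 1) * (real n - 6)" using 1 by simp
    then have "12 * real n \<le> (real n + 3) * (real n + 2)" by (simp add: algebra_simps)
    then have "12 * real n * N 2 \<le> (real n + 3) * (real n + 2) * N 2"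
      using pos[of 2] by (intro mult_right_mono) auto
    also have "\<dots> = (real n + 3) * (3 * N 3)" by (simp only: N3 mult.assoc)
    also have "\<dots> = 12 * N 4" using N4 by simp
    finally have "real n * N 2 \<le> N (2 * 2)" by simp
    then have "real n * N d \<le> N (2 * d)" by (rule ge) (rule assms)
    then show ?thesis using assms by (auto intro: add_increasing2)
  next
    case 2
    then have d2: "real n * N 2 \<le> N (2 * 2) + real n * (real n - 1) / 2"
      and d3: "real n * N 3 \<le> N (2 * 3)"
      using N2 N3 N4 N5 N6 by auto
    show ?thesis
    proof (cases "d = 2")
      case False
      then have "real n * N d \<le> N (2 * d)" using assms by (intro ge[OF d3]) auto
      then show ?thesis using assms by (auto intro: add_increasing2)
    qed (use d2 in simp)
  qed
  then show ?thesis by (simp add: N_def)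
qed

text \<open>With t = N_d - s this says that every s \<le> N_{d-1} violates the inequality defining
  \<open>s_min\<close>. At t = M the identity n L = L + d M reduces it to
  \<open>sum_num_forms_less\<close>, whose right-hand side is chosen for this purpose; from there on
  t(t+1)/2 - n t does not decrease, as M \<ge> n.\<close>

lemma num_forms_lower:
  assumes "n \<ge> 4" "d \<ge> 2" and t: "t \<ge> real (num_forms (n - 1) d)"
  shows "t * (t + 1) / 2 - real n * t > real (num_forms n (2 * d)) - real n * real (num_forms n d)"
proof -
  define c where "c = n - 1"
  have c: "n = Suc c" "c \<ge> 3" using assms by (auto simp: c_def)
  define M where "M = real (num_forms c d)"
  define L where "L = real (num_forms n (d - 1))"
  have Nd: "real (num_forms n d) = L + M"
    using num_forms_rec[of c "d - 1"] c assms by (simp add: L_def M_def)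
  have "real (num_forms n (2 * d)) = real (num_forms n d) + (\<Sum>j=1..d. real (num_forms c (d + j)))"
    using num_forms_sum[of c d d] c by (simp add: mult_2)
  also have "\<dots> < L + M + M * (M - 1 + 2 * real d) / 2"
  proof -
    have "(\<Sum>j=1..d. real (num_forms c (d + j))) < M * (M - 1 + 2 * real d) / 2"
      using sum_num_forms_less[of d c] c(2) assms(2) by (simp add: M_def)
    then show ?thesis using Nd by linarith
  qed
  finally have A: "real (num_forms n (2 * d)) < L + M + M * (M - 1 + 2 * real d) / 2" .
  have "real c * L = real d * M"
  proof -
    have "real c * L = real (c + (d - 1)) * real (num_forms c (d - 1))"
      using num_forms_Suc_vars[of c "d - 1"] c by (simp add: L_def)
    also have "\<dots> = real d * M"
      using num_forms_Suc_degree[of c "d - 1"] c assms by (simp add: M_def)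
    finally show ?thesis .
  qed
  then have B: "real n * L = L + real d * M" using c by (simp add: algebra_simps)
  have "real c + 1 \<le> M"
  proof -
    have "num_forms c 2 \<le> num_forms c d"
      using num_forms_mono[of c 2 "d - 2"] c assms by (simp del: add_2_eq_Suc)
    then have "real (num_forms c 2) \<le> M" by (simp add: M_def)
    moreover have "2 * real (num_forms c 2) = real c * (real c + 1)"
      using num_forms_Suc_degree[of c 0] num_forms_Suc_degree[of c 1] c
      by (simp add: num_forms_def numeral_2_eq_2 mult.commute)
    moreover have "2 * (real c + 1) \<le> real c * (real c + 1)"
      using c by (intro mult_right_mono) auto
    ultimately have "2 * (real c + 1) \<le> 2 * M" by argo
    then show ?thesis by simp
  qed
  moreover have "M \<le> t" using t by (simp add: M_def c_def)
  ultimately have "0 \<le> (t - M) * (t + M + 1 - 2 * real n)"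
    using c(1) by (intro mult_nonneg_nonneg) simp_all
  then have "M * (M + 1) / 2 - real n * M \<le> t * (t + 1) / 2 - real n * t"
    by (simp add: field_simps)
  with A B show ?thesis by (simp add: Nd field_simps)
qed

lemma binom2_real: "real_of_int (binom2 a) = real_of_int a * (real_of_int a - 1) / 2"
proof -
  have "even (a * (a - 1))" by simp
  then have "2 * binom2 a = a * (a - 1)" by (simp add: binom2_def)
  then have "2 * real_of_int (binom2 a) = real_of_int a * (real_of_int a - 1)"
    by (metis of_int_1 of_int_diff of_int_mult of_int_numeral)
  then show ?thesis by simp
qed

text \<open>On the integers a least element needs a lower bound; shifting by \<open>l\<close>
  reduces the question to natural numbers.\<close>

lemma int_Least_bounded_below:
  fixes P :: "int \<Rightarrow> bool"
  assumes "P a" "\<And>x. P x \<Longrightarrow> l < x"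
  shows "P (LEAST x. P x)" "(LEAST x. P x) \<le> a" "l < (LEAST x. P x)"
proof -
  define k where "k = (LEAST k. P (l + int k))"
  have "P (l + int (nat (a - l)))" using assms(1) assms(2)[OF assms(1)] by simp
  then have k: "P (l + int k)" unfolding k_def by (rule LeastI)
  have min: "l + int k \<le> x" if "P x" for x
  proof -
    have "P (l + int (nat (x - l)))" using that assms(2)[OF that] by simp
    then have "k \<le> nat (x - l)" unfolding k_def by (rule Least_le)
    then show ?thesis using assms(2)[OF that] by linarith
  qed
  have "(LEAST x. P x) = l + int k" using k min by (rule Least_equality)
  then show "P (LEAST x. P x)" "(LEAST x. P x) \<le> a" "l < (LEAST x. P x)"
    using k min[OF assms(1)] assms(2)[OF k] by auto
qed

text \<open>N - n is a solution and nothing up to N_{d-1} is one, negative integers included, so the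
  minimum exists and lies between the two.\<close>

lemma s_min_bounds:
  assumes n: "n \<ge> 4" "d \<ge> 2"
  defines "N \<equiv> int (num_forms n d)"
  shows "binom2 (N - s_min n d + 1) \<le> int (num_forms n (2 * d)) - int n * s_min n d"
    and "s_min n d \<le> N - int n" and "int (num_forms n (d - 1)) < s_min n d"
proof -
  let ?P = "\<lambda>s. binom2 (N - s + 1) \<le> int (num_forms n (2 * d)) - int n * s"
  have P: "?P s \<longleftrightarrow> real_of_int (N - s) * (real_of_int (N - s) + 1) / 2
      \<le> real (num_forms n (2 * d)) - real n * real_of_int s" for s
  proof -
    have "?P s \<longleftrightarrow> real_of_int (binom2 (N - s + 1)) \<le> real_of_int (int (num_forms n (2 * d)) - int n * s)"
      by (simp only: of_int_le_iff)
    then show ?thesis by (simp add: binom2_real mult.commute)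
  qed
  have base: "?P (N - int n)"
    unfolding P using num_forms_upper[OF n] by (simp add: N_def field_simps)
  have bound: "int (num_forms n (d - 1)) < s" if "?P s" for s
  proof (rule ccontr)
    assume *: "\<not> int (num_forms n (d - 1)) < s"
    have "num_forms n d = num_forms n (d - 1) + num_forms (n - 1) d"
      using num_forms_rec[of "n - 1" "d - 1"] n by simp
    then have "real (num_forms (n - 1) d) \<le> real_of_int (N - s)" using * by (simp add: N_def)
    from num_forms_lower[OF n this] that show False
      unfolding P by (simp add: N_def algebra_simps)
  qed
  note * = int_Least_bounded_below[of ?P, OF base bound]
  have "s_min n d = (LEAST s. ?P s)" by (simp only: s_min_def N_def)
  with * show "?P (s_min n d)" "s_min n d \<le> N - int n" "int (num_forms n (d - 1)) < s_min n d"
    by (simp_all only:)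
qed

subsection \<open>Sums of squares vanishing on general points\<close>

theorem corollary3p9:
  fixes n d :: nat and s :: int
  assumes "n = CARD('n::finite)" and "n \<ge> 4" and "d \<ge> 2"
    and "s = s_min n d"
  shows "int (num_forms n (d - 1)) < s \<and> s < int (num_forms n d) \<and>
    (iarrobino_kanev TYPE('n) d (nat s) \<longrightarrow>
       max_sos_length TYPE('n) d \<ge> enat (num_forms n d - nat s) \<and>
       for_general_points (nat s) (\<lambda>Z :: (real ^ 'n) set set.
         for_generic_vanishing_sos d Z (\<lambda>f. sos_length d f = num_forms n d - nat s)))"
proof -
  define N where "N = num_forms n d"
  define \<sigma> where "\<sigma> = nat s"
  define \<tau> where "\<tau> = N - \<sigma>"
  have s: "binom2 (int N - s + 1) \<le> int (num_forms n (2 * d)) - int n * s" "s \<le> int N - int n"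
    "int (num_forms n (d - 1)) < s"
    using s_min_bounds[OF assms(2,3)] assms(4) by (simp_all add: N_def)
  have \<sigma>: "int \<sigma> = s" "num_forms n (d - 1) \<le> \<sigma>" "\<sigma> + n \<le> N"
    using s(2,3) by (auto simp: \<sigma>_def)
  have \<tau>: "int N - int \<sigma> = int \<tau>" using \<sigma>(3) by (simp add: \<tau>_def)
  let ?I = "\<lambda>Z :: (real ^ 'n) set set. vanishing_ideal Z"
  have main: "max_sos_length TYPE('n) d \<ge> enat \<tau> \<and>
       for_general_points \<sigma> (\<lambda>Z :: (real ^ 'n) set set.
         for_generic_vanishing_sos d Z (\<lambda>f. sos_length d f = \<tau>))"
    if ik: "iarrobino_kanev TYPE('n) d \<sigma>"
  proof -
    \<comment> \<open>The exceptional triples with n \<ge> 4 have s = N_d - 1, against s + n \<le>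
      N_d.\<close>
    have generic: "(n, d, \<sigma>) \<notin> {(3, 2, 5), (4, 2, 9), (5, 2, 14)}"
    proof
      assume "(n, d, \<sigma>) \<in> {(3, 2, 5), (4, 2, 9), (5, 2, 14)}"
      moreover have "num_forms 4 2 = 10" "num_forms 5 2 = 15"
        by (simp_all add: num_forms_def numeral_eq_Suc)
      ultimately show False using \<sigma>(3) assms(2) by (auto simp: N_def)
    qed
    note ik[unfolded iarrobino_kanev_def Let_def, folded assms(1), folded N_def,
        unfolded \<tau> if_not_P[OF generic]]
    \<comment> \<open>The inequality defining \<open>s_min\<close> says that the second entry is the
      larger one.\<close>
    moreover have "max (int (n * \<sigma>)) (int (num_forms n (2 * d)) - binom2 (int \<tau> + 1))
        = int (num_forms n (2 * d)) - binom2 (int \<tau> + 1)"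
      using s(1) \<sigma>(1) \<tau> by (simp add: max_def)
    ultimately have "for_general_points \<sigma> (\<lambda>Z. int (hilbert_fun (2 * d) (ideal_mult (?I Z) (?I Z))) =
        int (num_forms n (2 * d)) - binom2 (int \<tau> + 1))" by simp
    \<comment> \<open>All three generic properties are placed on one open set; the bound in degree
      \<open>d - 1\<close> uses N_{d-1} of the points and leaves dimension 0.\<close>
    then have "for_general_points \<sigma> (\<lambda>Z. (int (hilbert_fun (2 * d) (ideal_mult (?I Z) (?I Z))) =
        int (num_forms n (2 * d)) - binom2 (int \<tau> + 1) \<and>
        dim (forms_through d Z) + \<sigma> \<le> num_forms CARD('n) d) \<and>
        dim (forms_through (d - 1) Z) + num_forms n (d - 1) \<le> num_forms CARD('n) (d - 1))"
      using \<sigma> assms(1) by (intro for_general_points_conj_dim) (auto simp: N_def)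
    then obtain U where U: "zariski_open \<sigma> U" "U \<noteq> {}"
      and UP: "\<And>z. z \<in> U \<Longrightarrow> (int (hilbert_fun (2 * d) (ideal_mult (?I (z ` {..<\<sigma>})) (?I (z ` {..<\<sigma>})))) =
        int (num_forms n (2 * d)) - binom2 (int \<tau> + 1) \<and>
        dim (forms_through d (z ` {..<\<sigma>})) + \<sigma> \<le> num_forms CARD('n) d) \<and>
        dim (forms_through (d - 1) (z ` {..<\<sigma>})) + num_forms n (d - 1) \<le> num_forms CARD('n) (d - 1)"
      unfolding for_general_points_def by blast
    have result: "for_generic_vanishing_sos d (z ` {..<\<sigma>}) (\<lambda>f. sos_length d f = \<tau>) \<and>
        (\<exists>f\<in>sos_cone d :: 'n rpoly set. sos_length d f = \<tau>)" if "z \<in> U" for z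
    proof -
      let ?Z = "z ` {..<\<sigma>}"
      have "dim (forms_through (d - 1) ?Z) = 0" using UP[OF that] assms(1) by simp
      then have low: "forms_through (d - 1) ?Z \<subseteq> {0}"
        by (rule dim_forms_zero[rotated]) (auto simp: forms_through_def)
      have dim: "dim (forms_through d ?Z) \<le> \<tau>"
      proof -
        have "dim (forms_through d ?Z) + \<sigma> \<le> N"
          using UP[OF that] unfolding N_def assms(1) by blast
        then show ?thesis by (simp add: \<tau>_def)
      qed
      have hilb: "2 * num_forms CARD('n) (2 * d) =
          2 * hilbert_fun (2 * d) (ideal_mult (?I ?Z) (?I ?Z)) + \<tau> * (\<tau> + 1)"
      proof -
        have "2 * binom2 (int \<tau> + 1) = int (\<tau> * (\<tau> + 1))"
          by (simp add: binom2_def distrib_right)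
        then have "2 * int (num_forms n (2 * d)) =
            2 * int (hilbert_fun (2 * d) (ideal_mult (?I ?Z) (?I ?Z))) + int (\<tau> * (\<tau> + 1))"
          using UP[OF that] by linarith
        then show ?thesis unfolding assms(1) by linarith
      qed
      have "d \<ge> 1" using assms(3) by simp
      then obtain b :: "nat \<Rightarrow> 'n rpoly" where b: "\<And>i. i < \<tau> \<Longrightarrow> b i \<in> forms_through d ?Z"
        "forms_through d ?Z \<subseteq> span (b ` {..<\<tau>})"
        "\<And>u x. (\<Sum>x\<in>index_pairs \<tau>. u x *\<^sub>R (case x of (j, i) \<Rightarrow> b j * b i)) = 0 \<Longrightarrow>
          x \<in> index_pairs \<tau> \<Longrightarrow> u x = 0"
        using independent_products[OF _ low dim hilb] by blast
      note length = generic_sos_length[where b = b and t = \<tau>, OF b(1,2)]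
      show ?thesis by (intro conjI length) (assumption | fact b(3))+
    qed
    from U(2) result obtain f :: "'n rpoly" where f: "f \<in> sos_cone d" "sos_length d f = \<tau>" by blast
    then have "enat \<tau> \<le> max_sos_length TYPE('n) d"
      unfolding max_sos_length_def by (intro SUP_upper2[OF f(1)]) simp
    moreover have "for_general_points \<sigma> (\<lambda>Z :: (real ^ 'n) set set.
        for_generic_vanishing_sos d Z (\<lambda>f. sos_length d f = \<tau>))"
      unfolding for_general_points_def using U result by blast
    ultimately show ?thesis by blast
  qed
  have "s < int N" using s(2) assms(2) by simp
  then show ?thesis
    using s(3) main unfolding \<sigma>_def[symmetric] N_def[symmetric] \<tau>_def[symmetric] by blast
qed

end
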